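(* There is an integer $N_0$ such that the following holds. Let $N\ge N_0$ be an integer with $N-1\neq F_n-2$ for all $n\ge 2$, let $A>0$, and let $\varphi:\Sigma\to\mathbb{R}$ be the potential $$\varphi(x)=\begin{cases}-\log\left(1+\frac{1}{\delta(x)}\right) & \text{if } \delta(x)\ge N,\\ -A & \text{otherwise,}\end{cases}$$ (with $\varphi(x)=0$ when $\delta(x)=+\infty$). Let $\beta_c$ be the (freezing) phase transition point of the pressure function $\beta\mapsto\mathcal{P}(\beta)$ of $\varphi$. Then $\beta_c\notin\,]0,2]$.
   Context: $\Sigma=\{0,1\}^{\mathbb{N}}$ is the one-sided full shift, with shift map $\sigma(x_0x_1x_2\cdots)=x_1x_2x_3\cdots$ and distance $d(x,y)=2^{-n(x,y)}$, $n(x,y)=\min\{k: x_k\ne y_k\}$. Fibonacci numbers: $F_0=1$, $F_1=2$, $F_{n+1}=F_n+F_{n-1}$. Finite Fibonacci words: $\omega_0=0$, $\omega_1=01$, $\omega_{n+1}=\omega_n\omega_{n-1}$ for $n\ge1$ (so $|\omega_n|=F_n$). The infinite Fibonacci word is $\omega=\lim_n\omega_n\in\Sigma$; $L(\omega)$ is the set of finite factors (finite blocks of consecutive letters) of $\omega$. $\mathbb{K}=\overline{\{\sigma^n(\omega):n\in\mathbb{N}\}}$ is the associated subshift, which carries a unique $\sigma$-invariant probability measure $\mu_{\mathbb{K}}$. For $x\in\Sigma$, $\delta(x)\in\mathbb{N}\cup\{+\infty\}$ is the maximal length of a prefix of $x$ belonging to $L(\omega)$; $\delta(x)=+\infty$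 if and only if $x\in\mathbb{K}$. The pressure function is $\mathcal{P}(\beta)=\sup_{\mu}\{h_\mu+\beta\int\varphi\,d\mu\}$, the supremum being over $\sigma$-invariant probability measures on $\Sigma$, where $h_\mu$ is the Kolmogorov entropy; a measure attaining the supremum is called an equilibrium state for $\beta\varphi$. It is known (Bruin–Leplaideur) that a freezing phase transition occurs: there is a parameter beyond which, for every $\beta$, the unique equilibrium state for $\beta\varphi$ is $\mu_{\mathbb{K}}$. The transition point $\beta_c$ is the least parameter such that for every $\beta>\beta_c$ the unique equilibrium state for $\beta\varphi$ is $\mu_{\mathbb{K}}$. *)

theory Defs
  imports "HOL-Probability.Probability" "HOL-Number_Theory.Fib"
begin

section \<open>The full shift\<close>

text \<open>Points of \<open>\<Sigma>\<close> are functions \<open>nat \<Rightarrow> bool\<close>, where \<open>False\<close> is the letter 0 and \<open>True\<close> the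
  letter 1. Topology and Borel sets are those of the library's product topology, which is the
  topology of \<open>shift_dist\<close> (lemma \<open>open_iff_shift_dist\<close>).\<close>

type_synonym point = "nat \<Rightarrow> bool"

definition shift :: "point \<Rightarrow> point" where
  "shift x = (\<lambda>n. x (Suc n))"

definition shift_dist :: "point \<Rightarrow> point \<Rightarrow> real" where
  "shift_dist x y = (if x = y then 0 else (1/2) ^ (LEAST k. x k \<noteq> y k))"

lemma shift_funpow: "(shift ^^ n) x = (\<lambda>k. x (n + k))"
  by (induction n arbitrary: x) (auto simp: shift_def)

lemma shift_dist_less_iff: "shift_dist x y < (1/2) ^ n \<longleftrightarrow> (\<forall>k\<le>n. x k = y k)"
proof (cases "x = y")
  case False
  then have ex: "\<exists>k. x k \<noteq> y k"
    by auto
  define m where "m = (LEAST k. x k \<noteq> y k)"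
  have m: "x m \<noteq> y m"
    unfolding m_def by (rule LeastI_ex[OF ex])
  have lt: "x k = y k" if "k < m" for k
    using not_less_Least[of k "\<lambda>k. x k \<noteq> y k"] that by (auto simp: m_def)
  have "shift_dist x y < (1/2) ^ n \<longleftrightarrow> n < m"
    using False by (simp add: shift_dist_def m_def)
  also have "\<dots> \<longleftrightarrow> (\<forall>k\<le>n. x k = y k)"
    using m lt by (meson le_less_trans not_le)
  finally show ?thesis .
qed (simp add: shift_dist_def)

lemma open_prefix: "open {y :: point. \<forall>k\<le>n. x k = y k}"
proof -
  have "{y :: point. \<forall>k\<le>n. x k = y k} = (\<Pi>\<^sub>E i\<in>UNIV. if i \<le> n then {x i} else UNIV)"
    by (auto simp: PiE_iff split: if_splits)
  moreover have "open (\<Pi>\<^sub>E i\<in>UNIV. if i \<le> n then {x i} else UNIV)"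
    by (rule open_PiE) (auto intro: Topological_Spaces.open_discrete finite_subset[of _ "{..n}"])
  ultimately show ?thesis
    by simp
qed

lemma open_iff_prefix:
  fixes U :: "point set"
  shows "open U \<longleftrightarrow> (\<forall>x\<in>U. \<exists>n. \<forall>y. (\<forall>k\<le>n. x k = y k) \<longrightarrow> y \<in> U)"
proof
  assume U: "open U"
  show "\<forall>x\<in>U. \<exists>n. \<forall>y. (\<forall>k\<le>n. x k = y k) \<longrightarrow> y \<in> U"
  proof
    fix x assume "x \<in> U"
    then obtain X where X: "x \<in> (\<Pi>\<^sub>E i\<in>UNIV. X i)" "finite {i. X i \<noteq> topspace euclidean}"
        "(\<Pi>\<^sub>E i\<in>UNIV. X i) \<subseteq> U"
      using product_topology_open_contains_basis[of "\<lambda>_. euclidean" UNIV U x] U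
      unfolding open_fun_def by blast
    obtain n where n: "\<forall>i\<in>{i. X i \<noteq> UNIV}. i \<le> n"
      using X(2) by (auto simp: finite_nat_set_iff_bounded_le)
    have "y \<in> U" if "\<forall>k\<le>n. x k = y k" for y
    proof -
      have "y i \<in> X i" for i
      proof (cases "i \<le> n")
        case True
        then have "y i = x i"
          using that by simp
        then show ?thesis
          using X(1) by (simp add: PiE_iff)
      next
        case False
        then have "X i = UNIV"
          using n by blast
        then show ?thesis
          by simp
      qed
      then show ?thesis
        using X(3) by (auto simp: PiE_iff)
    qed
    then show "\<exists>n. \<forall>y. (\<forall>k\<le>n. x k = y k) \<longrightarrow> y \<in> U"
      by blast
  qed
next
  assume *: "\<forall>x\<in>U. \<exists>n. \<forall>y. (\<forall>k\<le>n. x k = y k) \<longrightarrow> y \<in> U"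
  have "\<exists>T. open T \<and> x \<in> T \<and> T \<subseteq> U" if x: "x \<in> U" for x
  proof -
    obtain n where "\<forall>y. (\<forall>k\<le>n. x k = y k) \<longrightarrow> y \<in> U"
      using * x by blast
    then show ?thesis
      by (intro exI[of _ "{y. \<forall>k\<le>n. x k = y k}"] conjI open_prefix) auto
  qed
  then show "open U"
    by (subst open_subopen) blast
qed

lemma open_iff_shift_dist:
  "open U \<longleftrightarrow> (\<forall>x\<in>U. \<exists>e>0. \<forall>y. shift_dist x y < e \<longrightarrow> y \<in> U)"
  unfolding open_iff_prefix
proof (intro ball_cong refl iffI)
  fix x assume "\<exists>n. \<forall>y. (\<forall>k\<le>n. x k = y k) \<longrightarrow> y \<in> U"
  then show "\<exists>e>0. \<forall>y. shift_dist x y < e \<longrightarrow> y \<in> U"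
    unfolding shift_dist_less_iff[symmetric]
    by (elim exE, rename_tac n, rule_tac x = "(1/2) ^ n" in exI) simp
next
  fix x assume "\<exists>e>0. \<forall>y. shift_dist x y < e \<longrightarrow> y \<in> U"
  then obtain e where e: "e > 0" "\<forall>y. shift_dist x y < e \<longrightarrow> y \<in> U"
    by blast
  obtain n where "(1/2::real) ^ n < e"
    using real_arch_pow_inv[OF e(1), of "1/2"] by auto
  then have "\<forall>y. (\<forall>k\<le>n. x k = y k) \<longrightarrow> y \<in> U"
    using e(2) unfolding shift_dist_less_iff[symmetric] by (auto intro: less_trans)
  then show "\<exists>n. \<forall>y. (\<forall>k\<le>n. x k = y k) \<longrightarrow> y \<in> U" ..
qed

section \<open>The Fibonacci subshift\<close>

text \<open>The indexing used here is \<open>F\<^sub>0 = 1\<close>, \<open>F\<^sub>1 = 2\<close>.\<close>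

definition Fibo :: "nat \<Rightarrow> nat" where
  "Fibo n = fib (n + 2)"

lemma Fibo_simps: "Fibo 0 = 1" "Fibo (Suc 0) = 2" "Fibo (Suc (Suc n)) = Fibo (Suc n) + Fibo n"
  by (simp_all add: Fibo_def numeral_eq_Suc)

fun fib_word :: "nat \<Rightarrow> bool list" where
  "fib_word 0 = [False]"
| "fib_word (Suc 0) = [False, True]"
| "fib_word (Suc (Suc n)) = fib_word (Suc n) @ fib_word n"

lemma length_fib_word: "length (fib_word n) = Fibo n"
  by (induction n rule: fib_word.induct) (simp_all add: Fibo_simps)

text \<open>Letter \<open>i\<close> of the limit is letter \<open>i\<close> of any \<open>\<omega>\<^sub>n\<close> that is long enough, such as \<open>\<omega>\<^sub>i\<close>
  (lemma \<open>fib_word_nth\<close>).\<close>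

definition fib_omega :: point where
  "fib_omega i = fib_word i ! i"

lemma less_Fibo: "n < Fibo n"
proof (induction n rule: fib_word.induct)
  case (3 n)
  then show ?case by (simp add: Fibo_simps)
qed (simp_all add: Fibo_simps)

lemma fib_word_prefix:
  assumes "m \<le> n" "i < Fibo m"
  shows "fib_word n ! i = fib_word m ! i"
  using assms(1)
proof (induction n rule: dec_induct)
  case (step k)
  have "mono Fibo"
    unfolding Fibo_def by (intro monoI fib_mono) simp
  then have "i < Fibo k"
    using assms(2) step.hyps(1) by (meson less_le_trans monoD)
  then have "fib_word (Suc k) ! i = fib_word k ! i"
    by (cases k) (auto simp: nth_append length_fib_word Fibo_simps)
  then show ?case
    using step.IH by simp
qed simp

lemma fib_word_nth:
  assumes "i < length (fib_word n)"
  shows "fib_word n ! i = fib_omega i"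
  using assms fib_word_prefix[of n i i] fib_word_prefix[of i n i] less_Fibo[of i]
  by (cases "n \<le> i") (auto simp: fib_omega_def length_fib_word)

definition factors :: "point \<Rightarrow> bool list set" where
  "factors x = {map x [i..<i + n] | i n. True}"

definition fib_subshift :: "point set" where
  "fib_subshift = closure (range (\<lambda>n. (shift ^^ n) fib_omega))"

definition delta :: "point \<Rightarrow> enat" where
  "delta x = (SUP n\<in>{n. map x [0..<n] \<in> factors fib_omega}. enat n)"

lemma prefix_in_factors_iff:
  "map x [0..<n] \<in> factors y \<longleftrightarrow> (\<exists>i. \<forall>k<n. x k = y (i + k))"
proof
  assume "map x [0..<n] \<in> factors y"
  then obtain i m where im: "map x [0..<n] = map y [i..<i + m]"
    by (auto simp: factors_def)
  have "m = n"
    using arg_cong[OF im, of length] by simp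
  then have "x k = y (i + k)" if "k < n" for k
    using arg_cong[OF im, of "\<lambda>l. l ! k"] that by simp
  then show "\<exists>i. \<forall>k<n. x k = y (i + k)"
    by blast
next
  assume "\<exists>i. \<forall>k<n. x k = y (i + k)"
  then obtain i where "\<forall>k<n. x k = y (i + k)" ..
  then have "map x [0..<n] = map y [i..<i + n]"
    by (intro nth_equalityI) auto
  then show "map x [0..<n] \<in> factors y"
    by (auto simp: factors_def)
qed

lemma delta_eq_infinity_iff: "delta x = \<infinity> \<longleftrightarrow> x \<in> fib_subshift"
proof -
  let ?A = "{n. map x [0..<n] \<in> factors fib_omega}"
  have down: "m \<in> ?A" if "n \<in> ?A" "m \<le> n" for m n
    using that by (auto simp: prefix_in_factors_iff)
  have "delta x = \<infinity> \<longleftrightarrow> (\<forall>n. n \<in> ?A)"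
  proof
    assume inf: "delta x = \<infinity>"
    show "\<forall>n. n \<in> ?A"
    proof
      fix n
      have "enat n < (SUP n\<in>?A. enat n)"
        using inf by (simp add: delta_def)
      then obtain m where "m \<in> ?A" "enat n < enat m"
        by (auto simp: less_SUP_iff)
      then show "n \<in> ?A"
        using down[of m n] by simp
    qed
  next
    assume "\<forall>n. n \<in> ?A"
    then have "enat n \<le> delta x" for n
      unfolding delta_def by (intro SUP_upper) auto
    then show "delta x = \<infinity>"
      by (metis enat_ord_code(4) enat_ord_simps(1) not_infinity_eq not_less_eq_eq order_refl)
  qed
  also have "\<dots> \<longleftrightarrow> (\<forall>n. \<exists>i. \<forall>k\<le>n. x k = fib_omega (i + k))"
    by (simp add: prefix_in_factors_iff) (meson less_Suc_eq_le order.strict_implies_order)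
  also have "\<dots> \<longleftrightarrow> x \<in> fib_subshift"
  proof
    assume *: "\<forall>n. \<exists>i. \<forall>k\<le>n. x k = fib_omega (i + k)"
    show "x \<in> fib_subshift"
      unfolding fib_subshift_def closure_iff_nhds_not_empty
    proof (intro allI impI)
      fix A V :: "point set" assume V: "V \<subseteq> A" "open V" "x \<in> V"
      then obtain n where n: "\<forall>y. (\<forall>k\<le>n. x k = y k) \<longrightarrow> y \<in> V"
        unfolding open_iff_prefix by blast
      obtain i where "\<forall>k\<le>n. x k = fib_omega (i + k)"
        using * by blast
      then have "(shift ^^ i) fib_omega \<in> V"
        using n by (simp add: shift_funpow)
      then show "range (\<lambda>n. (shift ^^ n) fib_omega) \<inter> A \<noteq> {}"
        using V(1) by blast
    qed
  next
    assume x: "x \<in> fib_subshift"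
    show "\<forall>n. \<exists>i. \<forall>k\<le>n. x k = fib_omega (i + k)"
    proof
      fix n
      have "range (\<lambda>n. (shift ^^ n) fib_omega) \<inter> {y. \<forall>k\<le>n. x k = y k} \<noteq> {}"
        using x open_prefix[of n x] unfolding fib_subshift_def closure_iff_nhds_not_empty by blast
      then show "\<exists>i. \<forall>k\<le>n. x k = fib_omega (i + k)"
        by (auto simp: shift_funpow)
    qed
  qed
  finally show ?thesis .
qed

section \<open>Entropy, pressure, equilibrium states\<close>

definition invariant_prob :: "point measure \<Rightarrow> bool" where
  "invariant_prob M \<longleftrightarrow> prob_space M \<and> sets M = sets borel \<and> distr M M shift = M"

definition partition_entropy :: "'a measure \<Rightarrow> 'a set set \<Rightarrow> real" where
  "partition_entropy M P = - (\<Sum>A\<in>P. measure M A * ln (measure M A))"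

text \<open>The join of \<open>P, T\<^sup>-\<^sup>1 P, \<dots>, T\<^sup>-\<^sup>(\<^sup>n\<^sup>-\<^sup>1\<^sup>) P\<close>.\<close>

definition dynamical_partition :: "'a measure \<Rightarrow> ('a \<Rightarrow> 'a) \<Rightarrow> 'a set set \<Rightarrow> nat \<Rightarrow> 'a set set" where
  "dynamical_partition M T P n =
     common_refinement ((\<lambda>i. (\<lambda>A. (T ^^ i) -` A \<inter> space M) ` P) ` {..<n})"

definition entropy_wrt :: "'a measure \<Rightarrow> ('a \<Rightarrow> 'a) \<Rightarrow> 'a set set \<Rightarrow> ereal" where
  "entropy_wrt M T P = lim (\<lambda>n. ereal (partition_entropy M (dynamical_partition M T P n) / real n))"

definition kolmogorov_entropy :: "'a measure \<Rightarrow> ('a \<Rightarrow> 'a) \<Rightarrow> ereal" where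
  "kolmogorov_entropy M T =
     (SUP P\<in>{P. finite P \<and> partition_on (space M) P \<and> P \<subseteq> sets M}. entropy_wrt M T P)"

definition free_energy :: "(point \<Rightarrow> real) \<Rightarrow> real \<Rightarrow> point measure \<Rightarrow> ereal" where
  "free_energy \<phi> \<beta> M = kolmogorov_entropy M shift + ereal (\<beta> * (\<integral>x. \<phi> x \<partial>M))"

definition pressure :: "(point \<Rightarrow> real) \<Rightarrow> real \<Rightarrow> ereal" where
  "pressure \<phi> \<beta> = (SUP M\<in>{M. invariant_prob M}. free_energy \<phi> \<beta> M)"

definition equilibrium_state :: "(point \<Rightarrow> real) \<Rightarrow> real \<Rightarrow> point measure \<Rightarrow> bool" where
  "equilibrium_state \<phi> \<beta> M \<longleftrightarrow> invariant_prob M \<and> free_energy \<phi> \<beta> M = pressure \<phi> \<beta>"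

section \<open>The potential and its freezing transition\<close>

definition mu_K :: "point measure" where
  "mu_K = (THE M. invariant_prob M \<and> measure M fib_subshift = 1)"

definition frozen_beyond :: "(point \<Rightarrow> real) \<Rightarrow> real \<Rightarrow> bool" where
  "frozen_beyond \<phi> b \<longleftrightarrow> (\<forall>\<beta>>b. \<forall>M. equilibrium_state \<phi> \<beta> M \<longleftrightarrow> M = mu_K)"

definition is_transition_point :: "(point \<Rightarrow> real) \<Rightarrow> real \<Rightarrow> bool" where
  "is_transition_point \<phi> \<beta>c \<longleftrightarrow>
     frozen_beyond \<phi> \<beta>c \<and> (\<forall>b. frozen_beyond \<phi> b \<longrightarrow> \<beta>c \<le> b)"

definition potential :: "nat \<Rightarrow> real \<Rightarrow> point \<Rightarrow> real" where
  "potential N A x =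
     (if enat N \<le> delta x
      then (case delta x of enat k \<Rightarrow> - ln (1 + 1 / real k) | \<infinity> \<Rightarrow> 0)
      else - A)"

end

theory Submission
  imports Defs
begin

text \<open>
  At every \<open>\<beta> > 2\<close> freezing would force \<open>h(\<mu>) + \<beta> \<integral>\<phi> d\<mu> \<le> h(\<mu>\<^sub>K) + \<beta> \<integral>\<phi> d\<mu>\<^sub>K\<close> for all invariant
  \<open>\<mu>\<close>; it suffices to find \<open>\<mu>\<close> with \<open>h(\<mu>) + 2 \<integral>\<phi> d\<mu> > 0\<close> and to see that the right-hand side is 0.

  Let \<open>p = F\<^sub>k\<^sub>+\<^sub>1\<close>, \<open>q = F\<^sub>k\<close>, and substitute \<open>\<omega>\<^sub>k\<^sub>+\<^sub>1\<close> and \<open>\<omega>\<^sub>k\<close> for the letters of a sequence of independent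
  letters, taken with probabilities 3/7 and 4/7; \<open>\<mu>\<close> is the stationary version (a tower) of the
  resulting random point. All substituted sequences share a prefix of length \<open>p + q - 2\<close> and
  differ right after it according to their first letter. The former bounds \<open>\<delta>\<close> from below, whatever
  the letters are, so that \<open>\<phi>\<close> does not see \<open>A\<close> once \<open>k\<close> is large, and the sum of
  \<open>ln (1 + 1 / \<delta>)\<close> over a block telescopes; each block costs on average at most
  \<open>(25 ln (7/5) + 12 ln (9/5)) / 49\<close>, using the pair of letters that starts there. The latter makes
  every cylinder of length \<open>n\<close> have measure at most \<open>const * exp (- n ln (7/3) / p)\<close>, which bounds the
  entropy from below. With \<open>q / p\<close> near the inverse golden ratio the entropy of a block
  exceeds twice its cost.

  As \<open>\<integral>\<phi> d\<mu> \<rightarrow> 0\<close> for \<open>k \<rightarrow> \<infinity>\<close> and \<open>h(\<mu>\<^sub>K) \<le> ln 2\<close>, letting \<open>\<beta> \<rightarrow> \<infinity>\<close> gives \<open>\<integral>\<phi> d\<mu>\<^sub>K = 0\<close>. So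
  \<open>\<mu>\<^sub>K\<close> lives on the subshift, which has at most \<open>n + 2\<close> words of length \<open>n\<close> for infinitely many \<open>n\<close>,
  and its entropy is 0.
\<close>

section \<open>Entropy of finite-valued observables\<close>

text \<open>Shannon entropy, in nats, of the partition into the fibres of \<open>X\<close>. The
  explicit sum matches \<open>partition_entropy\<close>; \<open>ent_eq_entropy\<close> opens it to
  the inequalities known for \<open>entropy\<close>.\<close>

definition ent :: "'a measure \<Rightarrow> ('a \<Rightarrow> 'b) \<Rightarrow> real" where
  "ent M X = - (\<Sum>v\<in>X ` space M. measure M (X -` {v} \<inter> space M) * ln (measure M (X -` {v} \<inter> space M)))"

context prob_space
begin

lemma information_space_exp: "information_space M (exp 1)"
  by unfold_locales simp

lemma ent_eq_entropy:
  assumes "simple_function M X"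
  shows "ent M X = entropy (exp 1) (count_space (X ` space M)) X"
proof -
  interpret information_space M "exp 1" by (rule information_space_exp)
  show ?thesis
    using entropy_simple_distributed[OF simple_distributedI[OF assms measure_nonneg refl]]
    by (simp add: ent_def log_def)
qed

lemma ent_nonneg: "0 \<le> ent M X"
proof -
  have "t * ln t \<le> 0" if "0 \<le> t" "t \<le> 1" for t :: real
    using that by (cases "t = 0") (auto simp: mult_nonneg_nonpos)
  then show ?thesis
    unfolding ent_def by (simp add: sum_nonpos)
qed

lemma ent_pair_le:
  assumes "simple_function M X" "simple_function M Y"
  shows "ent M (\<lambda>x. (X x, Y x)) \<le> ent M X + ent M Y"
proof -
  interpret information_space M "exp 1" by (rule information_space_exp)
  show ?thesis
    using entropy_chain_rule[OF assms] conditional_entropy_less_eq_entropy[OF assms(2,1)]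
    by (simp add: ent_eq_entropy assms simple_function_Pair)
qed

lemma ent_cong: "(\<And>x. x \<in> space M \<Longrightarrow> X x = Y x) \<Longrightarrow> ent M X = ent M Y"
proof -
  assume *: "\<And>x. x \<in> space M \<Longrightarrow> X x = Y x"
  then have "X ` space M = Y ` space M" "\<And>v. X -` {v} \<inter> space M = Y -` {v} \<inter> space M"
    by auto
  then show ?thesis unfolding ent_def by simp
qed

text \<open>Choosing a point in every fibre of \<open>X\<close> makes \<open>Y\<close> a function of
  \<open>X\<close>, so this is the data processing inequality. The form with pairs of points spares
  an explicit factor map in applications.\<close>

lemma simple_function_determined:
  assumes X: "simple_function M X"
    and det: "\<And>x y. x \<in> space M \<Longrightarrow> y \<in> space M \<Longrightarrow> X x = X y \<Longrightarrow> Y x = Y y"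
  shows "simple_function M Y" and "ent M Y \<le> ent M X"
proof -
  interpret information_space M "exp 1" by (rule information_space_exp)
  define f where "f v = Y (SOME x. x \<in> space M \<and> X x = v)" for v
  have f: "Y x = (f \<circ> X) x" if "x \<in> space M" for x
  proof -
    have "(SOME y. y \<in> space M \<and> X y = X x) \<in> space M \<and> X (SOME y. y \<in> space M \<and> X y = X x) = X x"
      by (rule someI[of _ x]) (simp add: that)
    then show ?thesis
      using det[OF that] by (simp add: f_def)
  qed
  have fX: "simple_function M (f \<circ> X)"
    using X by (rule simple_function_compose)
  show "simple_function M Y"
    by (subst simple_function_cong[OF f]) (simp_all add: fX)
  have "ent M Y = ent M (f \<circ> X)"
    using f by (rule ent_cong)
  also have "\<dots> \<le> ent M X"
    using entropy_data_processing[OF X, of f] by (simp add: ent_eq_entropy X fX)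
  finally show "ent M Y \<le> ent M X" .
qed

text \<open>Subadditivity for pairs, iterated. \<open>restrict\<close> freezes the entries outside
  \<open>J\<close>, so the joint observable again takes finitely many values.\<close>

lemma ent_family:
  assumes "finite J" "\<And>j. j \<in> J \<Longrightarrow> simple_function M (Z j)"
  shows "simple_function M (\<lambda>x. restrict (\<lambda>j. Z j x) J) \<and>
    ent M (\<lambda>x. restrict (\<lambda>j. Z j x) J) \<le> (\<Sum>j\<in>J. ent M (Z j))"
  using assms
proof (induction J rule: finite_induct)
  case empty
  have "simple_function M (\<lambda>x. restrict (\<lambda>j. Z j x) {})"
    by (simp add: restrict_def)
  moreover have "ent M (\<lambda>x. restrict (\<lambda>j. Z j x) {}) = 0"
    by (simp add: ent_def restrict_def vimage_def image_constant_conv not_empty prob_space)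
  ultimately show ?case by (simp only: sum.empty order_refl simp_thms)
next
  case (insert j J)
  let ?R = "\<lambda>J x. restrict (\<lambda>j. Z j x) J"
  have s: "simple_function M (Z j)" "simple_function M (?R J)"
    using insert.prems insert.IH by blast+
  have p: "simple_function M (\<lambda>x. (Z j x, ?R J x))"
    using s by (rule simple_function_Pair)
  have det: "?R (insert j J) x = ?R (insert j J) y" if "(Z j x, ?R J x) = (Z j y, ?R J y)" for x y
  proof
    fix i
    have *: "Z j x = Z j y \<and> ?R J x = ?R J y"
      using that by (simp only: prod.inject)
    then have "?R J x i = ?R J y i"
      by (simp only:)
    with *[THEN conjunct1] show "?R (insert j J) x i = ?R (insert j J) y i"
      by (cases "i = j"; cases "i \<in> J") simp_all
  qed
  have "ent M (?R (insert j J)) \<le> ent M (\<lambda>x. (Z j x, ?R J x))"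
    by (rule simple_function_determined(2)[OF p]) (rule det)
  also have "\<dots> \<le> ent M (Z j) + ent M (?R J)"
    using s by (rule ent_pair_le)
  also have "\<dots> \<le> (\<Sum>i\<in>insert j J. ent M (Z i))"
    using insert.prems insert.IH insert.hyps by (simp del: restrict_apply)
  finally have "ent M (?R (insert j J)) \<le> (\<Sum>i\<in>insert j J. ent M (Z i))" .
  moreover have "simple_function M (?R (insert j J))"
    by (rule simple_function_determined(1)[OF p]) (rule det)
  ultimately show ?case by (intro conjI)
qed

lemma ent_comp:
  assumes X: "simple_function M X" and T: "T \<in> measurable M M" "distr M M T = M"
  shows "ent M (\<lambda>x. X (T x)) = ent M X"
proof -
  have *: "measure M ((\<lambda>x. X (T x)) -` {v} \<inter> space M) = measure M (X -` {v} \<inter> space M)" for v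
  proof -
    have "measure M (X -` {v} \<inter> space M) = measure (distr M M T) (X -` {v} \<inter> space M)"
      by (simp add: T(2))
    also have "\<dots> = measure M (T -` (X -` {v} \<inter> space M) \<inter> space M)"
      using X T(1) by (intro measure_distr) (auto dest: simple_functionD)
    also have "T -` (X -` {v} \<inter> space M) \<inter> space M = (\<lambda>x. X (T x)) -` {v} \<inter> space M"
      using T(1) by (auto dest: measurable_space)
    finally show ?thesis by simp
  qed
  have "(\<lambda>x. X (T x)) ` space M \<subseteq> X ` space M"
    using T(1) by (auto dest: measurable_space)
  \<comment> \<open>Composing with \<open>T\<close> may lose values of \<open>X\<close>; by
    invariance their fibres are null, so the two sums agree.\<close>
  moreover have "measure M (X -` {v} \<inter> space M) = 0" if "v \<notin> (\<lambda>x. X (T x)) ` space M" for v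
  proof -
    have "(\<lambda>x. X (T x)) -` {v} \<inter> space M = {}" using that by auto
    then show ?thesis using *[of v] by simp
  qed
  ultimately show ?thesis
    unfolding ent_def * using X
    by (intro arg_cong[where f = uminus] sum.mono_neutral_left) (auto dest: simple_functionD)
qed

lemma sum_fibers:
  assumes X: "simple_function M X"
  shows "(\<Sum>v\<in>X ` space M. measure M (X -` {v} \<inter> space M)) = 1"
proof -
  have "(\<Sum>v\<in>X ` space M. measure M (X -` {v} \<inter> space M)) =
      measure M (\<Union>v\<in>X ` space M. X -` {v} \<inter> space M)"
    using X by (intro finite_measure_finite_Union[symmetric])
      (auto simp: disjoint_family_on_def dest: simple_functionD)
  also have "(\<Union>v\<in>X ` space M. X -` {v} \<inter> space M) = space M" by auto
  finally show ?thesis by (simp add: prob_space)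
qed

text \<open>Values outside \<open>V\<close> have null fibres, and only fibres of positive measure
  count. The \<open>AE\<close> form serves measures that live on the subshift up to a null
  set.\<close>

lemma ent_le_ln_card:
  assumes X: "simple_function M X" and V: "finite V" "AE x in M. X x \<in> V"
  shows "ent M X \<le> ln (card V)"
proof -
  interpret information_space M "exp 1" by (rule information_space_exp)
  let ?V = "X ` space M \<inter> {v. measure M (X -` {v} \<inter> space M) \<noteq> 0}"
  have sub: "?V \<subseteq> V"
  proof
    fix v assume v: "v \<in> ?V"
    show "v \<in> V"
    proof (rule ccontr)
      assume "v \<notin> V"
      have "AE x in M. x \<notin> X -` {v} \<inter> space M"
        using V(2) by (rule eventually_mono) (use \<open>v \<notin> V\<close> in auto)
      moreover have "X -` {v} \<inter> space M \<in> sets M"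
        using X by (auto dest: simple_functionD)
      ultimately have "measure M (X -` {v} \<inter> space M) = 0"
        using prob_eq_0 by blast
      then show False using v by simp
    qed
  qed
  have fin: "finite ?V" using sub V(1) by (rule finite_subset)
  have ne: "?V \<noteq> {}"
  proof
    assume "?V = {}"
    then have "(\<Sum>v\<in>X ` space M. measure M (X -` {v} \<inter> space M)) = 0"
      by (intro sum.neutral) auto
    then show False using sum_fibers[OF X] by simp
  qed
  have "ent M X \<le> log (exp 1) (card ?V)"
    using entropy_le_card_not_0[OF simple_distributedI[OF X measure_nonneg refl]]
    by (simp add: ent_eq_entropy X)
  also have "\<dots> \<le> ln (card V)"
  proof -
    have "0 < card ?V" using ne fin card_gt_0_iff by blast
    then show ?thesis using card_mono[OF V(1) sub] by (simp add: log_def)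
  qed
  finally show ?thesis .
qed

text \<open>Entropy is the average of \<open>- ln m\<close> over the fibres, \<open>m\<close> being
  the measure of the fibre, so a uniform bound on \<open>m\<close> suffices.\<close>

lemma ent_ge:
  assumes X: "simple_function M X" and le: "\<And>v. measure M (X -` {v} \<inter> space M) \<le> exp (- s)"
  shows "s \<le> ent M X"
proof -
  have *: "m * ln m \<le> m * (- s)" if m: "0 \<le> m" "m \<le> exp (- s)" for m :: real
  proof (cases "m = 0")
    case False
    then have "ln m \<le> ln (exp (- s))" using m by (subst ln_le_cancel_iff) auto
    then show ?thesis using m by (intro mult_left_mono) simp_all
  qed simp
  have "(\<Sum>v\<in>X ` space M. measure M (X -` {v} \<inter> space M) * ln (measure M (X -` {v} \<inter> space M)))
      \<le> (\<Sum>v\<in>X ` space M. measure M (X -` {v} \<inter> space M) * (- s))"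
    by (intro sum_mono * le) simp
  also have "\<dots> = - s"
    unfolding sum_distrib_right[symmetric] sum_fibers[OF X] by simp
  finally show ?thesis by (simp add: ent_def)
qed

text \<open>Meant for the error sets of an approximation, whose entropy must vanish with their
  measure.\<close>

lemma ent_indicator_le:
  assumes E: "E \<in> sets M"
  shows "ent M (\<lambda>x. x \<in> E) \<le> 3 * sqrt (measure M E)"
proof -
  define \<eta> :: "real \<Rightarrow> real" where "\<eta> t = - (t * ln t)" for t
  have \<eta>0: "0 \<le> \<eta> t" if "0 \<le> t" "t \<le> 1" for t
    using that by (cases "t = 0") (auto simp: \<eta>_def mult_nonneg_nonpos)
  have inv: "\<eta> t \<le> 1 - t" if t: "0 \<le> t" for t
  proof (cases "t = 0")
    case False
    then have "ln (1 / t) \<le> 1 / t - 1" using t by (intro ln_le_minus_one) simp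
    then have "t * ln (1 / t) \<le> t * (1 / t - 1)" using t by (intro mult_left_mono)
    then show ?thesis using False t by (simp add: \<eta>_def ln_div algebra_simps)
  qed (simp add: \<eta>_def)
  \<comment> \<open>\<open>ln t = 2 * ln (sqrt t)\<close> turns the bound \<open>inv\<close> at
    \<open>sqrt t\<close> into a square root bound at \<open>t\<close>.\<close>
  have sq: "\<eta> t \<le> 2 * sqrt t" if t: "0 \<le> t" for t
  proof -
    have "\<eta> t = sqrt t * (2 * \<eta> (sqrt t))"
      using t by (cases "t = 0") (simp_all add: \<eta>_def ln_sqrt)
    also have "\<dots> \<le> sqrt t * (2 * 1)"
      using inv[of "sqrt t"] real_sqrt_ge_zero[OF t] by (intro mult_left_mono) linarith+
    finally show ?thesis by simp
  qed
  let ?m = "measure M E"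
  have fib: "(\<lambda>x. x \<in> E) -` {True} \<inter> space M = E" "(\<lambda>x. x \<in> E) -` {False} \<inter> space M = space M - E"
    using sets.sets_into_space[OF E] by auto
  have "ent M (\<lambda>x. x \<in> E) = (\<Sum>v\<in>(\<lambda>x. x \<in> E) ` space M. \<eta> (measure M ((\<lambda>x. x \<in> E) -` {v} \<inter> space M)))"
    by (simp add: ent_def \<eta>_def sum_negf)
  also have "\<dots> \<le> (\<Sum>v\<in>UNIV. \<eta> (measure M ((\<lambda>x. x \<in> E) -` {v} \<inter> space M)))"
    by (intro sum_mono2 \<eta>0) auto
  also have "\<dots> = \<eta> ?m + \<eta> (1 - ?m)"
    by (simp add: UNIV_bool fib prob_compl[OF E])
  also have "\<dots> \<le> 2 * sqrt ?m + ?m"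
    using sq[of ?m] inv[of "1 - ?m"] by simp
  finally have *: "ent M (\<lambda>x. x \<in> E) \<le> 2 * sqrt ?m + ?m" .
  have "?m \<le> sqrt ?m"
    by (rule real_le_rsqrt) (simp add: power2_eq_square mult_left_le measure_nonneg)
  then show ?thesis using * by linarith
qed

end

section \<open>Subadditivity and the approximation of partitions by cylinders\<close>

text \<open>The limit is the infimum of \<open>a n / n\<close>; the second conclusion lets a single
  \<open>n\<close> bound it from above.\<close>

lemma fekete:
  fixes a :: "nat \<Rightarrow> real"
  assumes sub: "\<And>m n. a (m + n) \<le> a m + a n" and nonneg: "\<And>n. 0 \<le> a n"
  obtains L where "(\<lambda>n. a n / n) \<longlonglongrightarrow> L" "\<And>n. 1 \<le> n \<Longrightarrow> L \<le> a n / n"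
proof -
  let ?S = "(\<lambda>n. a n / real n) ` {1..}"
  define L where "L = Inf ?S"
  have bdd: "bdd_below ?S"
    by (rule bdd_belowI[of _ 0]) (auto simp: nonneg)
  have lower: "L \<le> a n / n" if "1 \<le> n" for n
    unfolding L_def using that by (intro cInf_lower bdd) auto
  have mult: "a (q * m + r) \<le> q * a m + a r" for q m r
  proof (induction q)
    case (Suc q)
    have "a (Suc q * m + r) = a (m + (q * m + r))" by (simp add: algebra_simps)
    also have "\<dots> \<le> a m + a (q * m + r)" by (rule sub)
    finally show ?case using Suc by (simp add: algebra_simps)
  qed simp
  have "(\<lambda>n. a n / n) \<longlonglongrightarrow> L"
  proof (rule LIMSEQ_I)
    fix e :: real assume e: "0 < e"
    have "\<exists>y\<in>?S. y < L + e / 2"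
      using e cInf_lessD[of ?S "L + e / 2"] by (auto simp: L_def)
    then obtain m where m: "1 \<le> m" "a m / m < L + e / 2" by auto
    \<comment> \<open>Divide \<open>n\<close> by the near-optimal \<open>m\<close>: \<open>C\<close>
      dominates \<open>a\<close> at every remainder and disappears after division by
      \<open>n\<close>.\<close>
    define C where "C = (\<Sum>i<m. a i)"
    have C: "a r \<le> C" if "r < m" for r
      unfolding C_def using that by (intro member_le_sum nonneg) auto
    obtain N :: nat where N: "2 * C / e < N" using reals_Archimedean2 by blast
    have "norm (a n / n - L) < e" if n: "max 1 N \<le> n" for n
    proof -
      have n0: "0 < real n" using n by simp
      have "a n \<le> (n div m) * a m + a (n mod m)"
        using mult[of "n div m" m "n mod m"] by simp
      also have "\<dots> \<le> (n div m) * a m + C"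
        using C[of "n mod m"] m(1) by simp
      also have "\<dots> \<le> n / m * a m + C"
        by (intro add_right_mono mult_right_mono nonneg of_nat_div_le_of_nat)
      finally have "a n / n \<le> (n / m * a m + C) / n"
        using n0 by (intro divide_right_mono) auto
      also have "\<dots> = a m / m + C / n"
        using n0 m(1) by (simp add: field_simps)
      also have "\<dots> < L + e / 2 + e / 2"
      proof (intro add_strict_mono m(2))
        have "2 * C / e < n" using N n by linarith
        then show "C / n < e / 2" using e n0 by (simp add: field_simps)
      qed
      finally show ?thesis using lower[of n] n by auto
    qed
    then show "\<exists>no. \<forall>n\<ge>no. norm (a n / n - L) < e" by blast
  qed
  then show thesis using lower that by blast
qed

section \<open>Partitions as observables, itineraries and cylinders\<close>

lemma borel_measurable_shift: "shift \<in> measurable borel borel"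
  unfolding shift_def
  by (intro borel_measurable_continuous_onI continuous_on_coordinatewise_then_product
      continuous_on_product_coordinates)

text \<open>Turns a partition into an observable, so that the entropy of partitions reduces to
  \<open>ent\<close>. The description is meaningful for partitions only.\<close>

definition cell :: "'a set set \<Rightarrow> 'a \<Rightarrow> 'a set" where
  "cell P x = (THE A. A \<in> P \<and> x \<in> A)"

lemma cell_eq:
  assumes "partition_on UNIV P" "A \<in> P" "x \<in> A"
  shows "cell P x = A"
  unfolding cell_def
  using assms by (intro the_equality) (auto simp: partition_on_def disjoint_def)

lemma in_cell:
  assumes "partition_on UNIV P"
  shows "cell P x \<in> P" "x \<in> cell P x"
proof -
  have "x \<in> \<Union>P"
    using assms by (simp add: partition_on_def)
  then obtain A where "A \<in> P" "x \<in> A" by (rule UnionE)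
  then show "cell P x \<in> P" "x \<in> cell P x"
    using cell_eq[OF assms] by simp_all
qed

lemma mem_iff_cell:
  assumes "partition_on UNIV P" "A \<in> P"
  shows "x \<in> A \<longleftrightarrow> cell P x = A"
  using assms cell_eq in_cell by metis

text \<open>The itinerary of length \<open>n\<close>; its fibres form the join of the first
  \<open>n\<close> preimages of the partition given by \<open>X\<close>.\<close>

definition name :: "(point \<Rightarrow> 'b) \<Rightarrow> nat \<Rightarrow> point \<Rightarrow> 'b list" where
  "name X n x = map (\<lambda>i. X ((shift ^^ i) x)) [0..<n]"

lemma name_eq_iff: "name X n x = name X n y \<longleftrightarrow> (\<forall>i<n. X ((shift ^^ i) x) = X ((shift ^^ i) y))"
  by (auto simp: name_def)

lemma name_letter: "name (\<lambda>x. x 0) n x = map x [0..<n]"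
  by (simp add: name_def shift_funpow)

definition cylindrical :: "nat \<Rightarrow> point set \<Rightarrow> bool" where
  "cylindrical m C \<longleftrightarrow> (\<forall>x y. (\<forall>k<m. x k = y k) \<longrightarrow> x \<in> C \<longrightarrow> y \<in> C)"

lemma cylindrical_iff: "cylindrical m C \<Longrightarrow> (\<And>k. k < m \<Longrightarrow> x k = y k) \<Longrightarrow> x \<in> C \<longleftrightarrow> y \<in> C"
  unfolding cylindrical_def by metis

lemma cylindrical_mono:
  assumes "cylindrical m C" "m \<le> n"
  shows "cylindrical n C"
  unfolding cylindrical_def
proof (intro allI impI)
  fix x y :: point assume "\<forall>k<n. x k = y k" "x \<in> C"
  then show "y \<in> C"
    using cylindrical_iff[OF assms(1), of x y] assms(2) by simp
qed

lemma open_cylindrical: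
  assumes "cylindrical m C"
  shows "open C"
  unfolding open_iff_prefix
proof (intro ballI exI[of _ m] allI impI)
  fix x y :: point assume "x \<in> C" "\<forall>k\<le>m. x k = y k"
  then show "y \<in> C"
    using cylindrical_iff[OF assms, of x y] by simp
qed

locale shift_invariant = prob_space M for M :: "point measure" +
  assumes sets_borel: "sets M = sets borel" and invariant: "distr M M shift = M"
begin

lemma space_UNIV: "space M = UNIV"
  using sets_eq_imp_space_eq[OF sets_borel] by simp

lemma measurable_shift_funpow: "(shift ^^ i) \<in> measurable M M"
proof (induction i)
  case (Suc i)
  have "shift \<in> measurable M M"
    using borel_measurable_shift measurable_cong_sets[OF sets_borel sets_borel] by blast
  then show ?case using Suc by (simp add: measurable_comp)
qed simp

lemma distr_shift_funpow: "distr M M (shift ^^ i) = M"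
proof (induction i)
  case 0
  then show ?case by (simp add: id_def distr_id)
next
  case (Suc i)
  have "distr M M (shift ^^ Suc i) = distr (distr M M (shift ^^ i)) M shift"
    using measurable_shift_funpow[of 1] measurable_shift_funpow[of i] by (simp add: distr_distr comp_def)
  then show ?case using Suc invariant by (simp add: comp_def)
qed

lemma simple_function_shift:
  assumes "simple_function M X"
  shows "simple_function M (\<lambda>x. X ((shift ^^ i) x))"
proof -
  have "X -` {v} \<in> sets M" for v
    using simple_functionD(2)[OF assms, of "{v}"] by (simp add: space_UNIV)
  then have "(shift ^^ i) -` (X -` {v}) \<in> sets M" for v
    using measurable_sets[OF measurable_shift_funpow, of "X -` {v}" i] by (simp add: space_UNIV)
  moreover have "finite (range (\<lambda>x. X ((shift ^^ i) x)))"
    using simple_functionD(1)[OF assms] by (rule finite_subset[rotated]) (auto simp: space_UNIV)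
  ultimately show ?thesis
    by (simp add: simple_function_def space_UNIV vimage_def)
qed

lemma ent_shift: "simple_function M X \<Longrightarrow> ent M (\<lambda>x. X ((shift ^^ i) x)) = ent M X"
  by (rule ent_comp[OF _ measurable_shift_funpow distr_shift_funpow])

lemma simple_function_name:
  assumes X: "simple_function M X"
  shows "simple_function M (name X n)"
proof (rule simple_function_determined(1))
  show "simple_function M (\<lambda>x. restrict (\<lambda>i. X ((shift ^^ i) x)) {..<n})"
    by (rule ent_family[THEN conjunct1]) (auto intro: simple_function_shift X)
  show "name X n x = name X n y" if "restrict (\<lambda>i. X ((shift ^^ i) x)) {..<n} = restrict (\<lambda>i. X ((shift ^^ i) y)) {..<n}" for x y
    unfolding name_eq_iff
  proof (intro allI impI)
    fix i assume "i < n"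
    then show "X ((shift ^^ i) x) = X ((shift ^^ i) y)"
      using fun_cong[OF that, of i] by simp
  qed
qed

text \<open>The long itinerary is determined by its first \<open>m\<close> entries and the itinerary
  of the shifted point, whose entropy is the same by invariance. This feeds
  \<open>fekete\<close>.\<close>

lemma ent_name_add:
  assumes X: "simple_function M X"
  shows "ent M (name X (m + n)) \<le> ent M (name X m) + ent M (name X n)"
proof -
  let ?Y = "\<lambda>x. name X n ((shift ^^ m) x)"
  have s: "simple_function M (name X m)" "simple_function M ?Y"
    by (intro simple_function_name simple_function_shift X)+
  have "ent M (name X (m + n)) \<le> ent M (\<lambda>x. (name X m x, ?Y x))"
  proof (rule simple_function_determined(2)[OF simple_function_Pair[OF s]])
    fix x y assume "(name X m x, ?Y x) = (name X m y, ?Y y)"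
    then have *: "\<forall>i<m. X ((shift ^^ i) x) = X ((shift ^^ i) y)"
        "\<forall>i<n. X ((shift ^^ (i + m)) x) = X ((shift ^^ (i + m)) y)"
      by (simp_all add: name_eq_iff funpow_add)
    show "name X (m + n) x = name X (m + n) y"
      unfolding name_eq_iff
    proof (intro allI impI)
      fix i assume "i < m + n"
      then show "X ((shift ^^ i) x) = X ((shift ^^ i) y)"
        using *(1) *(2)[rule_format, of "i - m"] by (cases "i < m") auto
    qed
  qed
  also have "\<dots> \<le> ent M (name X m) + ent M ?Y"
    using s by (rule ent_pair_le)
  also have "ent M ?Y = ent M (name X n)"
    by (intro ent_shift simple_function_name X)
  finally show ?thesis .
qed

text \<open>A point in a nonempty intersection decides which cell is picked at each time, so the
  members of the join are the fibres of the itinerary.\<close>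

lemma dynamical_partition_eq:
  assumes P: "partition_on UNIV P"
  shows "dynamical_partition M shift P n = (\<lambda>v. name (cell P) n -` {v}) ` range (name (cell P) n)"
proof -
  define Q where "Q i = (\<lambda>A. (shift ^^ i) -` A) ` P" for i
  have dp: "dynamical_partition M shift P n = common_refinement (Q ` {..<n})"
    by (simp add: dynamical_partition_def Q_def space_UNIV)
  have fiber: "name (cell P) n -` {name (cell P) n x} = {y. \<forall>i<n. cell P ((shift ^^ i) y) = cell P ((shift ^^ i) x)}" for x
    by (auto simp: name_eq_iff)
  have pre: "(shift ^^ i) -` cell P ((shift ^^ i) x) = {y. cell P ((shift ^^ i) y) = cell P ((shift ^^ i) x)}" for i x
    using mem_iff_cell[OF P] in_cell[OF P] by auto
  have mem: "B = (shift ^^ i) -` cell P ((shift ^^ i) x)" if "B \<in> Q i" "x \<in> B" for B i x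
    using that cell_eq[OF P] by (auto simp: Q_def)
  show ?thesis
  proof (intro equalityI subsetI)
    fix B assume "B \<in> dynamical_partition M shift P n"
    then obtain f where f: "f \<in> Pi (Q ` {..<n}) (\<lambda>R. R)" "B = \<Inter> (f ` Q ` {..<n})" "B \<noteq> {}"
      unfolding dp common_refinement by auto
    then obtain x where x: "x \<in> B" by auto
    have "f (Q i) = (shift ^^ i) -` cell P ((shift ^^ i) x)" if "i < n" for i
      using f(1) x that by (intro mem) (auto simp: f(2))
    then have "B = name (cell P) n -` {name (cell P) n x}"
      unfolding fiber f(2) by (auto simp: pre)
    then show "B \<in> (\<lambda>v. name (cell P) n -` {v}) ` range (name (cell P) n)" by blast
  next
    fix B assume "B \<in> (\<lambda>v. name (cell P) n -` {v}) ` range (name (cell P) n)"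
    then obtain x where B: "B = name (cell P) n -` {name (cell P) n x}" by auto
    \<comment> \<open>Choice functions take a partition, not a time, and different times may give
      the same \<open>Q i\<close>; hence \<open>f\<close> has to read the cell of \<open>x\<close>
      off \<open>R\<close> alone.\<close>
    define f where "f R = (THE A. A \<in> R \<and> x \<in> A)" for R
    have f: "f (Q i) = (shift ^^ i) -` cell P ((shift ^^ i) x)" for i
      unfolding f_def
    proof (rule the_equality)
      show "(shift ^^ i) -` cell P ((shift ^^ i) x) \<in> Q i \<and> x \<in> (shift ^^ i) -` cell P ((shift ^^ i) x)"
        using in_cell[OF P] by (auto simp: Q_def)
    qed (use mem in auto)
    have "B = \<Inter> (f ` Q ` {..<n})"
      unfolding B fiber by (auto simp: f pre)
    moreover have "f \<in> Pi (Q ` {..<n}) (\<lambda>R. R)"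
    proof -
      have "f (Q i) \<in> Q i" for i
        unfolding f using in_cell(1)[OF P] by (simp add: Q_def)
      then show ?thesis by auto
    qed
    moreover have "B \<noteq> {}" using B by auto
    ultimately show "B \<in> dynamical_partition M shift P n"
      unfolding dp common_refinement by blast
  qed
qed

lemma partition_entropy_name:
  assumes "partition_on UNIV P"
  shows "partition_entropy M (dynamical_partition M shift P n) = ent M (name (cell P) n)"
proof -
  have "inj_on (\<lambda>v. name (cell P) n -` {v}) (range (name (cell P) n))"
    by (rule inj_onI) auto
  then show ?thesis
    by (simp add: partition_entropy_def ent_def dynamical_partition_eq[OF assms] space_UNIV sum.reindex del: vimage_singleton_eq)
qed

lemma simple_function_cell:
  assumes "finite P" "partition_on UNIV P" "P \<subseteq> sets M"
  shows "simple_function M (cell P)"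
proof -
  have "range (cell P) \<subseteq> P"
    using in_cell[OF assms(2)] by auto
  moreover have "cell P -` {cell P x} \<in> sets M" for x
  proof -
    have "cell P -` {cell P x} = cell P x"
      using mem_iff_cell[OF assms(2) in_cell(1)[OF assms(2), of x]] by auto
    then show ?thesis
      using in_cell(1)[OF assms(2), of x] assms(3) by auto
  qed
  ultimately show ?thesis
    using assms by (auto simp: simple_function_def space_UNIV intro: finite_subset)
qed

text \<open>By \<open>fekete\<close>, the \<open>lim\<close> in \<open>entropy_wrt\<close> is a
  genuine limit and a lower bound of the sequence.\<close>

lemma entropy_wrt_limit:
  assumes P: "finite P" "partition_on UNIV P" "P \<subseteq> sets M"
  obtains L where "entropy_wrt M shift P = ereal L"
    "(\<lambda>n. ent M (name (cell P) n) / n) \<longlonglongrightarrow> L" "\<And>n. 1 \<le> n \<Longrightarrow> L \<le> ent M (name (cell P) n) / n"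
proof -
  obtain L where L: "(\<lambda>n. ent M (name (cell P) n) / n) \<longlonglongrightarrow> L" "\<And>n. 1 \<le> n \<Longrightarrow> L \<le> ent M (name (cell P) n) / n"
    using fekete[of "\<lambda>n. ent M (name (cell P) n)"] ent_name_add[OF simple_function_cell[OF P]] ent_nonneg
    by blast
  have "entropy_wrt M shift P = ereal L"
    unfolding entropy_wrt_def partition_entropy_name[OF P(2)] using L(1) by (intro limI) simp
  then show thesis using L that by blast
qed

text \<open>The sets approximable in measure by unions of cylinders of one length include the open
  sets and are closed under complements and countable unions.\<close>

lemma cylinder_approx:
  assumes A: "A \<in> sets M" and e: "0 < e"
  shows "\<exists>m C. cylindrical m C \<and> measure M (sym_diff A C) < e"
proof -
  define good where "good A \<longleftrightarrow> A \<in> sets M \<and> (\<forall>e>0. \<exists>m C. cylindrical m C \<and> measure M (sym_diff A C) < e)" for A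
  have meas: "C \<in> sets M" if "cylindrical m C" for m C
    using open_cylindrical[OF that] sets_borel by simp
  have incr: "good (\<Union>n. B n)" if B: "\<And>n. good (B n)" "incseq B" for B :: "nat \<Rightarrow> point set"
    unfolding good_def
  proof (intro conjI allI impI)
    have Bm: "range B \<subseteq> sets M" using B(1) by (auto simp: good_def)
    then show U: "(\<Union>n. B n) \<in> sets M" by blast
    fix e :: real assume e: "0 < e"
    have "(\<lambda>n. measure M (B n)) \<longlonglongrightarrow> measure M (\<Union>n. B n)"
      by (rule finite_Lim_measure_incseq[OF Bm B(2)])
    then have "\<exists>N. \<forall>n\<ge>N. dist (measure M (B n)) (measure M (\<Union>n. B n)) < e / 2"
      unfolding lim_sequentially using e by (elim allE[of _ "e / 2"]) simp
    then obtain n where "dist (measure M (B n)) (measure M (\<Union>n. B n)) < e / 2"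
      by blast
    moreover have "measure M ((\<Union>n. B n) - B n) = measure M (\<Union>n. B n) - measure M (B n)"
      using U Bm by (intro finite_measure_Diff) auto
    ultimately have n: "measure M ((\<Union>n. B n) - B n) < e / 2"
      unfolding dist_real_def by linarith
    obtain m C where C: "cylindrical m C" "measure M (sym_diff (B n) C) < e / 2"
      using B(1)[of n] half_gt_zero[OF e] unfolding good_def by meson
    have Bn: "B n \<in> sets M" using Bm by blast
    have "measure M (sym_diff (\<Union>n. B n) C) \<le> measure M (((\<Union>n. B n) - B n) \<union> sym_diff (B n) C)"
      using U Bn meas[OF C(1)] by (intro finite_measure_mono) auto
    also have "\<dots> \<le> measure M ((\<Union>n. B n) - B n) + measure M (sym_diff (B n) C)"
      using U Bn meas[OF C(1)] by (intro measure_Un_le) auto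
    finally show "\<exists>m C. cylindrical m C \<and> measure M (sym_diff (\<Union>n. B n) C) < e"
      using n C by (intro exI[of _ m] exI[of _ C]) auto
  qed
  have cyl: "good C" if "cylindrical m C" for m C
    unfolding good_def using that meas[OF that] by (auto intro!: exI[of _ m] exI[of _ C])
  have compl: "good (UNIV - B)" if B: "good B" for B
    unfolding good_def
  proof (intro conjI allI impI)
    show "UNIV - B \<in> sets M"
      using B sets.compl_sets[of B M] by (auto simp: good_def space_UNIV)
    fix e :: real assume "0 < e"
    then obtain m C where C: "cylindrical m C" "measure M (sym_diff B C) < e"
      using B by (auto simp: good_def)
    moreover have "cylindrical m (- C)"
      using C(1) unfolding cylindrical_def by (metis Compl_iff)
    moreover have "sym_diff (UNIV - B) (- C) = sym_diff B C" by blast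
    ultimately show "\<exists>m C. cylindrical m C \<and> measure M (sym_diff (UNIV - B) C) < e"
      by (intro exI[of _ m] exI[of _ "- C"]) simp
  qed
  have un: "good (B1 \<union> B2)" if B: "good B1" "good B2" for B1 B2
    unfolding good_def
  proof (intro conjI allI impI)
    show "B1 \<union> B2 \<in> sets M" using B by (auto simp: good_def)
    fix e :: real assume "0 < e"
    then have "0 < e / 2" by simp
    then obtain m1 C1 m2 C2 where C: "cylindrical m1 C1" "measure M (sym_diff B1 C1) < e / 2"
        "cylindrical m2 C2" "measure M (sym_diff B2 C2) < e / 2"
      using B unfolding good_def by meson
    have "cylindrical (max m1 m2) C1" "cylindrical (max m1 m2) C2"
      using C(1,3) by (auto intro: cylindrical_mono)
    then have c: "cylindrical (max m1 m2) (C1 \<union> C2)"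
      unfolding cylindrical_def by (metis Un_iff)
    have m: "B1 \<in> sets M" "B2 \<in> sets M" "C1 \<in> sets M" "C2 \<in> sets M"
      using B C(1,3) meas by (auto simp: good_def)
    have "measure M (sym_diff (B1 \<union> B2) (C1 \<union> C2)) \<le> measure M (sym_diff B1 C1 \<union> sym_diff B2 C2)"
      using m by (intro finite_measure_mono) auto
    also have "\<dots> \<le> measure M (sym_diff B1 C1) + measure M (sym_diff B2 C2)"
      using m by (intro measure_Un_le) auto
    finally show "\<exists>m C. cylindrical m C \<and> measure M (sym_diff (B1 \<union> B2) C) < e"
      using C c by (intro exI[of _ "max m1 m2"] exI[of _ "C1 \<union> C2"]) auto
  qed
  have "A \<in> sigma_sets UNIV {S. open S}"
    using A sets_borel by (simp add: borel_def)
  then have "good A"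
  proof induction
    case (Basic U)
    \<comment> \<open>The union of the cylinders of length \<open>n\<close> inside \<open>U\<close>;
      it increases to \<open>U\<close> because \<open>U\<close> is open.\<close>
    define B where "B n = {x. \<forall>y. (\<forall>k<n. x k = y k) \<longrightarrow> y \<in> U}" for n
    have "cylindrical n (B n)" for n
      unfolding cylindrical_def B_def by auto
    then have g: "good (B n)" for n by (rule cyl)
    have inc: "incseq B"
      by (auto simp: incseq_def B_def)
    have "U = (\<Union>n. B n)"
    proof (intro equalityI subsetI)
      fix x assume "x \<in> U"
      then obtain n where "\<forall>y. (\<forall>k\<le>n. x k = y k) \<longrightarrow> y \<in> U"
        using Basic open_iff_prefix[of U] by blast
      then have "x \<in> B (Suc n)" by (simp add: B_def less_Suc_eq_le)
      then show "x \<in> (\<Union>n. B n)" by blast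
    qed (auto simp: B_def)
    then show ?case using incr[OF g inc] by simp
  next
    case Empty
    show ?case by (rule cyl[of 0]) (simp add: cylindrical_def)
  next
    case (Compl B)
    then show ?case by (rule_tac compl)
  next
    case (Union B)
    have "good (\<Union>i\<le>n. B i)" for n
      by (induction n) (simp_all add: Union atMost_Suc un)
    moreover have "incseq (\<lambda>n. \<Union>i\<le>n. B i)"
      by (force simp: incseq_def)
    moreover have "(\<Union>n. \<Union>i\<le>n. B i) = (\<Union>i. B i)" by blast
    ultimately show ?case using incr[of "\<lambda>n. \<Union>i\<le>n. B i"] by simp
  qed
  then show ?thesis using e by (auto simp: good_def)
qed

section \<open>Kolmogorov entropy through cylinders\<close>

lemma simple_function_letter: "simple_function M (\<lambda>x. x 0)"
proof -
  have "{x :: point. x 0 = b} = {y. \<forall>k\<le>0. (\<lambda>_. b) k = y k}" for b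
    by auto
  then have "open {x :: point. x 0 = b}" for b
    using open_prefix[of 0 "\<lambda>_. b"] by simp
  then have "(\<lambda>x. x 0) -` {b} \<in> sets M" for b
    by (simp add: sets_borel vimage_def)
  then show ?thesis
    by (simp add: simple_function_def space_UNIV)
qed

text \<open>Quantitative core of the generator theorem of Kolmogorov and Sinai. The itinerary in
  \<open>P\<close> is determined by the first \<open>n + m\<close> letters and by the visits to the
  sets \<open>E A\<close>, where a cell differs from its approximation; each visit indicator has
  small entropy.\<close>

lemma ent_name_le_cylinders:
  fixes e :: real
  assumes P: "finite P" "partition_on UNIV P" "P \<subseteq> sets M" and e: "0 < e"
  shows "\<exists>m. \<forall>n. ent M (name (cell P) n) \<le> ent M (name (\<lambda>x. x 0) (n + m)) + n * e"
proof -
  define K where "K = real (card P) + 1"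
  have K: "0 < K" "real (card P) \<le> K" by (simp_all add: K_def)
  \<comment> \<open>Chosen so that \<open>3 * sqrt d = e / K\<close>: the error sets, at most
    \<open>K\<close> in number, then add at most \<open>e\<close> per time step.\<close>
  define d where "d = (e / (3 * K))\<^sup>2"
  have d: "0 < d" using e K by (simp add: d_def)
  have "\<forall>A\<in>P. \<exists>m C. cylindrical m C \<and> measure M (sym_diff A C) < d"
    using P(3) cylinder_approx[OF _ d] by blast
  then obtain m0 C where C0: "\<And>A. A \<in> P \<Longrightarrow> cylindrical (m0 A) (C A)"
      and Cd: "\<And>A. A \<in> P \<Longrightarrow> measure M (sym_diff A (C A)) < d"
    by metis
  define m where "m = Max (insert 0 (m0 ` P))"
  have C: "cylindrical m (C A)" if "A \<in> P" for A
    using C0[OF that] by (rule cylindrical_mono) (simp add: m_def P(1) that)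
  define E where "E A = sym_diff A (C A)" for A
  have E: "E A \<in> sets M" if "A \<in> P" for A
    using P(3) that open_cylindrical[OF C[OF that]] sets_borel by (auto simp: E_def)
  have sE: "simple_function M (\<lambda>x. x \<in> E A)" if "A \<in> P" for A
  proof -
    have "(\<lambda>x. x \<in> E A) -` {b} \<in> sets M" for b
    proof (cases b)
      case True
      then have "(\<lambda>x. x \<in> E A) -` {b} = E A" by auto
      then show ?thesis using E[OF that] by simp
    next
      case False
      then have "(\<lambda>x. x \<in> E A) -` {b} = space M - E A" by (auto simp: space_UNIV)
      then show ?thesis using E[OF that] by simp
    qed
    then show ?thesis by (simp add: simple_function_def space_UNIV)
  qed
  have entE: "ent M (\<lambda>x. x \<in> E A) \<le> e / K" if "A \<in> P" for A
  proof -
    have "ent M (\<lambda>x. x \<in> E A) \<le> 3 * sqrt (measure M (E A))"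
      using E[OF that] by (rule ent_indicator_le)
    also have "\<dots> \<le> 3 * sqrt d"
      using Cd[OF that] by (simp add: E_def)
    also have "\<dots> = e / K"
      using e K by (simp add: d_def)
    finally show ?thesis .
  qed
  have "ent M (name (cell P) n) \<le> ent M (name (\<lambda>x. x 0) (n + m)) + n * e" for n
  proof -
    let ?J = "P \<times> {..<n}"
    let ?Z = "\<lambda>(A, i) x. (shift ^^ i) x \<in> E A"
    let ?R = "\<lambda>x. restrict (\<lambda>j. ?Z j x) ?J"
    let ?Y = "name (\<lambda>x. x 0) (n + m)"
    have fam: "simple_function M ?R \<and> ent M ?R \<le> (\<Sum>j\<in>?J. ent M (?Z j))"
      by (rule ent_family) (use P(1) in \<open>auto intro!: simple_function_shift sE\<close>)
    have sY: "simple_function M ?Y"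
      by (intro simple_function_name simple_function_letter)
    have "ent M (name (cell P) n) \<le> ent M (\<lambda>x. (?Y x, ?R x))"
    proof (rule simple_function_determined(2)[OF simple_function_Pair[OF sY fam[THEN conjunct1]]])
      fix x y assume eq: "(?Y x, ?R x) = (?Y y, ?R y)"
      have Y: "x k = y k" if "k < n + m" for k
        using eq that by (simp add: name_eq_iff shift_funpow)
      have Z: "(shift ^^ i) x \<in> E A \<longleftrightarrow> (shift ^^ i) y \<in> E A" if "A \<in> P" "i < n" for A i
      proof -
        have "?R x = ?R y" using eq by (simp only: prod.inject)
        from fun_cong[OF this, of "(A, i)"] show ?thesis using that by simp
      qed
      have mem: "(shift ^^ i) x \<in> A \<longleftrightarrow> (shift ^^ i) y \<in> A" if "A \<in> P" "i < n" for A i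
      proof -
        have "(shift ^^ i) x \<in> C A \<longleftrightarrow> (shift ^^ i) y \<in> C A"
          by (rule cylindrical_iff[OF C[OF that(1)]]) (use Y that(2) in \<open>simp add: shift_funpow\<close>)
        then show ?thesis using Z[OF that] by (auto simp: E_def)
      qed
      show "name (cell P) n x = name (cell P) n y"
        unfolding name_eq_iff
      proof (intro allI impI)
        fix i assume "i < n"
        then have "(shift ^^ i) y \<in> cell P ((shift ^^ i) x)"
          using mem[OF in_cell(1)[OF P(2), of "(shift ^^ i) x"], of i] in_cell(2)[OF P(2), of "(shift ^^ i) x"]
          by blast
        then show "cell P ((shift ^^ i) x) = cell P ((shift ^^ i) y)"
          using cell_eq[OF P(2) in_cell(1)[OF P(2)], of "(shift ^^ i) y" "(shift ^^ i) x"] by simp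
      qed
    qed
    also have "\<dots> \<le> ent M ?Y + ent M ?R"
      by (rule ent_pair_le[OF sY fam[THEN conjunct1]])
    also have "ent M ?R \<le> (\<Sum>j\<in>?J. ent M (?Z j))"
      by (rule fam[THEN conjunct2])
    also have "\<dots> \<le> (\<Sum>j\<in>?J. e / K)"
      by (intro sum_mono) (use entE ent_shift[OF sE] in \<open>auto simp del: of_nat_add of_nat_Suc\<close>)
    also have "\<dots> = n * (card P * e / K)"
      by (simp add: card_cartesian_product)
    also have "\<dots> \<le> n * e"
      using e K by (intro mult_left_mono) (simp_all add: field_simps)
    finally show ?thesis by simp
  qed
  then show ?thesis by blast
qed

text \<open>One \<open>n\<close> for each \<open>e\<close> and \<open>m\<close> is enough, as the
  entropy of a partition lies below every term of its sequence. The overhang \<open>m\<close> is the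
  length of the cylinders approximating the cells.\<close>

lemma kolmogorov_entropy_le:
  fixes c :: real
  assumes *: "\<And>e m. 0 < e \<Longrightarrow> \<exists>n\<ge>1. ent M (name (\<lambda>x. x 0) (n + m)) \<le> n * (c + e)"
  shows "kolmogorov_entropy M shift \<le> ereal c"
  unfolding kolmogorov_entropy_def
proof (rule SUP_least)
  fix P assume "P \<in> {P. finite P \<and> partition_on (space M) P \<and> P \<subseteq> sets M}"
  then have P: "finite P" "partition_on UNIV P" "P \<subseteq> sets M"
    by (auto simp: space_UNIV)
  obtain L where L: "entropy_wrt M shift P = ereal L" "\<And>n. 1 \<le> n \<Longrightarrow> L \<le> ent M (name (cell P) n) / n"
    using entropy_wrt_limit[OF P] by metis
  have "L \<le> c + e" if e: "0 < e" for e
  proof -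
    have e2: "0 < e / 2" using e by simp
    obtain m where m: "\<And>n. ent M (name (cell P) n) \<le> ent M (name (\<lambda>x. x 0) (n + m)) + n * (e / 2)"
      using ent_name_le_cylinders[OF P e2] by blast
    obtain n where n: "1 \<le> n" "ent M (name (\<lambda>x. x 0) (n + m)) \<le> n * (c + e / 2)"
      using *[OF e2] by blast
    have "ent M (name (cell P) n) \<le> n * (c + e)"
      using m[of n] n(2) by (simp add: algebra_simps)
    then have "ent M (name (cell P) n) / n \<le> c + e"
      using n(1) by (simp add: field_simps)
    then show ?thesis using L(2)[OF n(1)] by linarith
  qed
  then have "L \<le> c" by (rule field_le_epsilon)
  then show "entropy_wrt M shift P \<le> ereal c" using L(1) by simp
qed

lemma kolmogorov_entropy_le_ln2: "kolmogorov_entropy M shift \<le> ereal (ln 2)"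
proof (rule kolmogorov_entropy_le)
  fix e :: real and m :: nat assume e: "0 < e"
  \<comment> \<open>Large enough for the \<open>m\<close> additional letters to cost less than
    \<open>n * e\<close>.\<close>
  obtain n :: nat where n: "m * ln 2 / e < n" using reals_Archimedean2 by blast
  have "ent M (name (\<lambda>x. x 0) (max 1 n + m)) \<le> ln (card {xs :: bool list. set xs \<subseteq> UNIV \<and> length xs = max 1 n + m})"
  proof (rule ent_le_ln_card)
    show "finite {xs :: bool list. set xs \<subseteq> UNIV \<and> length xs = max 1 n + m}"
      by (rule finite_lists_length_eq) simp
  qed (auto intro: simple_function_name simple_function_letter simp: name_letter)
  also have "\<dots> = (max 1 n + m) * ln 2"
    by (subst card_lists_length_eq) (simp_all add: ln_realpow)
  also have "m * ln 2 < max 1 n * e"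
  proof -
    have "m * ln 2 < n * e" using n e by (simp add: field_simps)
    also have "\<dots> \<le> max 1 n * e" using e by simp
    finally show ?thesis .
  qed
  then have "(max 1 n + m) * ln 2 \<le> max 1 n * (ln 2 + e)"
    by (simp add: algebra_simps)
  finally show "\<exists>n\<ge>1. ent M (name (\<lambda>x. x 0) (n + m)) \<le> n * (ln 2 + e)"
    by (intro exI[of _ "max 1 n"]) simp
qed

text \<open>The partition by the first letter already attains this much; the constant
  \<open>K\<close> disappears on division by \<open>n\<close>.\<close>

lemma kolmogorov_entropy_ge:
  assumes K: "\<And>n. n * s - K \<le> ent M (name (\<lambda>x. x 0) n)"
  shows "ereal s \<le> kolmogorov_entropy M shift"
proof -
  define P :: "point set set" where "P = {{x. x 0}, {x. \<not> x 0}}"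
  have "(\<lambda>x. x 0) -` {b} \<in> sets M" for b
    using simple_functionD(2)[OF simple_function_letter, of "{b}"] by (simp add: space_UNIV)
  from this[of True] this[of False] have sets: "P \<subseteq> sets M"
    by (simp add: P_def vimage_def)
  have "(\<lambda>_. True) \<in> {x :: point. x 0}" "(\<lambda>_. False) \<in> {x :: point. \<not> x 0}" by simp_all
  then have "{x :: point. x 0} \<noteq> {}" "{x :: point. \<not> x 0} \<noteq> {}" by blast+
  then have "{} \<notin> P" unfolding P_def by (metis insert_iff empty_iff)
  then have part: "partition_on UNIV P"
    by (intro partition_onI) (auto simp: P_def disjnt_def)
  have fin: "finite P" by (simp add: P_def)
  obtain L where L: "entropy_wrt M shift P = ereal L" "(\<lambda>n. ent M (name (cell P) n) / n) \<longlonglongrightarrow> L"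
    using entropy_wrt_limit[OF fin part sets] by metis
  have cell: "x 0 \<longleftrightarrow> y 0" if "cell P x = cell P y" for x y
    using mem_iff_cell[OF part, of "{x. x 0}"] that by (auto simp: P_def disjnt_def)
  have le: "ent M (name (\<lambda>x. x 0) n) \<le> ent M (name (cell P) n)" for n
  proof (rule simple_function_determined(2)[OF simple_function_name[OF simple_function_cell[OF fin part sets]]])
    fix x y assume "name (cell P) n x = name (cell P) n y"
    then show "name (\<lambda>x. x 0) n x = name (\<lambda>x. x 0) n y"
      unfolding name_eq_iff by (intro allI impI cell) simp
  qed
  have "s \<le> L"
  proof (rule tendsto_le[OF sequentially_bot L(2)])
    have "(\<lambda>n. s - K / real n) \<longlonglongrightarrow> s - 0"
      by (intro tendsto_intros lim_const_over_n)
    then show "(\<lambda>n. s - K / real n) \<longlonglongrightarrow> s" by simp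
    show "\<forall>\<^sub>F n in sequentially. s - K / real n \<le> ent M (name (cell P) n) / real n"
      using eventually_gt_at_top[of 0]
    proof eventually_elim
      case (elim n)
      have "n * s - K \<le> ent M (name (cell P) n)" using K[of n] le[of n] by linarith
      then have "(n * s - K) / n \<le> ent M (name (cell P) n) / n"
        by (intro divide_right_mono) simp_all
      then show ?case using elim by (simp add: diff_divide_distrib)
    qed
  qed
  then have "ereal s \<le> entropy_wrt M shift P" using L(1) by simp
  also have "\<dots> \<le> kolmogorov_entropy M shift"
    unfolding kolmogorov_entropy_def using fin part sets by (intro SUP_upper) (simp add: space_UNIV)
  finally show ?thesis .
qed

end

section \<open>Concatenation\<close>

definition conc :: "bool list \<Rightarrow> point \<Rightarrow> point" where
  "conc w y = (\<lambda>i. if i < length w then w ! i else y (i - length w))"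

lemma conc_Nil [simp]: "conc [] y = y"
  by (simp add: conc_def)

lemma conc_append: "conc (u @ w) y = conc u (conc w y)"
  by (auto simp: conc_def nth_append fun_eq_iff)

lemma conc_Cons_0 [simp]: "conc (t # ts) y 0 = t"
  by (simp add: conc_def)

lemma shift_conc_Cons [simp]: "shift (conc (t # ts) y) = conc ts y"
  by (auto simp: conc_def shift_def fun_eq_iff)

lemma funpow_shift_conc: "j \<le> length w \<Longrightarrow> (shift ^^ j) (conc w y) = conc (drop j w) y"
  by (auto simp: shift_funpow conc_def fun_eq_iff add.commute)

lemma funpow_shift_conc_add: "(shift ^^ (length w + j)) (conc w y) = (shift ^^ j) y"
  by (auto simp: shift_funpow conc_def fun_eq_iff)

lemma map_conc: "map (conc w y) [0..<length w] = w"
  by (rule nth_equalityI) (auto simp: conc_def)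

lemma map_upt_conc_cong: "n \<le> length w \<Longrightarrow> map (conc w y) [0..<n] = take n w"
  by (rule nth_equalityI) (auto simp: conc_def)

section \<open>Factors of the Fibonacci word\<close>

lemma mem_factors_iff: "w \<in> factors x \<longleftrightarrow> (\<exists>i. \<forall>j<length w. w ! j = x (i + j))"
proof
  assume "w \<in> factors x"
  then obtain i n where "w = map x [i..<i + n]" by (auto simp: factors_def)
  then show "\<exists>i. \<forall>j<length w. w ! j = x (i + j)" by (intro exI[of _ i]) simp
next
  assume "\<exists>i. \<forall>j<length w. w ! j = x (i + j)"
  then obtain i where "\<forall>j<length w. w ! j = x (i + j)" ..
  then have "w = map x [i..<i + length w]"
    by (intro nth_equalityI) auto
  then show "w \<in> factors x" by (auto simp: factors_def)
qed

lemma drop_factors: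
  assumes "w \<in> factors x"
  shows "drop j w \<in> factors x"
proof -
  obtain i where i: "\<forall>l<length w. w ! l = x (i + l)"
    using assms by (auto simp: mem_factors_iff)
  have "drop j w ! l = x ((i + j) + l)" if "l < length (drop j w)" for l
    using that i by (simp add: add.assoc)
  then show ?thesis unfolding mem_factors_iff by blast
qed

lemma infix_factors:
  assumes "fib_word n = u @ w @ v"
  shows "w \<in> factors fib_omega"
  unfolding mem_factors_iff
proof (intro exI[of _ "length u"] allI impI)
  fix j assume j: "j < length w"
  have "fib_word n ! (length u + j) = fib_omega (length u + j)"
    using j assms by (intro fib_word_nth) simp
  then show "w ! j = fib_omega (length u + j)"
    using j assms by (simp add: nth_append)
qed

lemma delta_ge:
  assumes "w \<in> factors fib_omega"
  shows "enat (length w) \<le> delta (conc w y)"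
  unfolding delta_def using assms by (intro SUP_upper) (simp add: map_conc)

section \<open>Powers of the Fibonacci substitution\<close>

text \<open>\<open>block k\<close> is the \<open>k\<close>-th power of the substitution \<open>0 \<mapsto> 01\<close>, \<open>1 \<mapsto> 0\<close>, applied to a letter.\<close>

definition block :: "nat \<Rightarrow> bool \<Rightarrow> bool list" where
  "block k s = (if s then fib_word k else fib_word (Suc k))"

lemma length_block: "length (block k s) = (if s then Fibo k else Fibo (Suc k))"
  by (simp add: block_def length_fib_word)

lemma length_block_pos: "0 < length (block k s)"
  using less_Fibo[of k] less_Fibo[of "Suc k"] by (simp add: length_block)

text \<open>The substitution on infinite sequences, computed letter by letter; blocks are nonempty,
  so the position decreases in the recursion.\<close>

function fib_subst :: "nat \<Rightarrow> point \<Rightarrow> point" where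
  "fib_subst k x i = (if i < length (block k (x 0)) then block k (x 0) ! i
    else fib_subst k (shift x) (i - length (block k (x 0))))"
  by auto
termination
proof (relation "Wellfounded.measure (\<lambda>(k, x, i). i)")
  fix k :: nat and x :: point and i :: nat
  assume "\<not> i < length (block k (x 0))"
  then have "i - length (block k (x 0)) < i"
    using length_block_pos[of k "x 0"] by linarith
  then show "((k, shift x, i - length (block k (x 0))), k, x, i) \<in> Wellfounded.measure (\<lambda>(k, x, i). i)"
    by simp
qed simp

declare fib_subst.simps [simp del]

lemma fib_subst_unfold: "fib_subst k x = conc (block k (x 0)) (fib_subst k (shift x))"
  by (auto simp: conc_def fib_subst.simps[of k x] fun_eq_iff)

lemma fib_subst_conc: "fib_subst k (conc ts y) = conc (concat (map (block k) ts)) (fib_subst k y)"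
proof (induction ts)
  case (Cons t ts)
  show ?case
    by (subst fib_subst_unfold) (simp add: Cons conc_append)
qed simp

text \<open>The longest common prefix of \<open>fib_word (Suc k) @ fib_word k\<close> and
  \<open>fib_word k @ fib_word (Suc k)\<close>, which differ exactly in the order of their last two letters.\<close>

fun common :: "nat \<Rightarrow> bool list" where
  "common 0 = [False]"
| "common (Suc k) = fib_word (Suc k) @ common k"

lemma length_common: "length (common k) + 2 = Fibo (k + 2)"
  by (induction k) (simp_all add: Fibo_simps length_fib_word)

text \<open>Near-commutation of consecutive Fibonacci words. Splitting off the left factor
  \<open>fib_word (Suc k)\<close> exchanges the two products, so the last two letters alternate with
  the parity of \<open>k\<close>.\<close>

lemma fib_word_swap:
  "fib_word (Suc k) @ fib_word k = common k @ [even k, odd k] \<and>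
   fib_word k @ fib_word (Suc k) = common k @ [odd k, even k]"
proof (induction k)
  case (Suc k)
  have "fib_word (Suc (Suc k)) @ fib_word (Suc k) = fib_word (Suc k) @ (fib_word k @ fib_word (Suc k))"
    by simp
  moreover have "fib_word (Suc k) @ fib_word (Suc (Suc k)) = fib_word (Suc k) @ (fib_word (Suc k) @ fib_word k)"
    by simp
  ultimately show ?case using Suc by simp
qed simp

lemma fib_word_Suc_prefix: "\<exists>r. fib_word (Suc n) = fib_word n @ r"
  by (cases n) auto

text \<open>If the first block is the shorter one, the next block, whichever it is, begins with
  \<open>fib_word (k - 1)\<close> and completes it to \<open>fib_word (Suc k)\<close>.\<close>

lemma fib_subst_starts:
  assumes "0 < k"
  shows "\<exists>y. fib_subst k x = conc (fib_word (Suc k)) y"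
proof (cases "x 0")
  case False
  then show ?thesis using fib_subst_unfold[of k x] by (auto simp: block_def)
next
  case True
  obtain j where j: "k = Suc j" using assms by (cases k) auto
  obtain r where r: "fib_word k = fib_word j @ r" using fib_word_Suc_prefix j by blast
  obtain r' where r': "fib_word (Suc k) = fib_word k @ r'" using fib_word_Suc_prefix by blast
  have "\<exists>u. block k (shift x 0) = fib_word j @ u"
    using r r' by (auto simp: block_def)
  then obtain u where u: "block k (shift x 0) = fib_word j @ u" ..
  have "fib_subst k x = conc (fib_word k) (conc (fib_word j) (conc u (fib_subst k (shift (shift x)))))"
    using fib_subst_unfold[of k x] fib_subst_unfold[of k "shift x"] True u by (simp add: block_def conc_append)
  also have "\<dots> = conc (fib_word (Suc k)) (conc u (fib_subst k (shift (shift x))))"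
    by (simp add: j conc_append)
  finally show ?thesis by blast
qed

text \<open>By \<open>fib_subst_starts\<close>, the first block is followed by enough letters to
  complete one of the two products of \<open>fib_word_swap\<close>. All images thus share
  \<open>common k\<close>, and the next letter reveals \<open>x 0\<close>.\<close>

lemma fib_subst_starts_letter:
  assumes "0 < k"
  shows "\<exists>y. fib_subst k x = conc (common k @ [even k \<noteq> x 0, odd k \<noteq> x 0]) y"
proof (cases "x 0")
  case True
  obtain y where "fib_subst k (shift x) = conc (fib_word (Suc k)) y"
    using fib_subst_starts[OF assms] by blast
  then have "fib_subst k x = conc (fib_word k @ fib_word (Suc k)) y"
    using fib_subst_unfold[of k x] True by (simp add: block_def conc_append)
  then show ?thesis using True fib_word_swap[of k] by auto
next
  case False
  obtain y where "fib_subst k (shift x) = conc (fib_word (Suc k)) y"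
    using fib_subst_starts[OF assms] by blast
  moreover obtain r where "fib_word (Suc k) = fib_word k @ r" using fib_word_Suc_prefix by blast
  ultimately have "fib_subst k x = conc (fib_word (Suc k) @ fib_word k) (conc r y)"
    using fib_subst_unfold[of k x] False by (simp add: block_def conc_append)
  then show ?thesis using False fib_word_swap[of k] by auto
qed

lemma fib_subst_common:
  assumes "0 < k"
  shows "\<exists>y. fib_subst k x = conc (common k) y"
  using fib_subst_starts_letter[OF assms, of x] by (auto simp: conc_append)

lemma fib_subst_letter:
  assumes "0 < k"
  shows "fib_subst k x (length (common k)) = (even k \<noteq> x 0)"
proof -
  obtain y where "fib_subst k x = conc (common k @ [even k \<noteq> x 0, odd k \<noteq> x 0]) y"
    using fib_subst_starts_letter[OF assms] by blast
  then show ?thesis by (simp add: conc_def nth_append)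
qed

text \<open>The part of a substituted sequence starting with the blocks of \<open>s\<close> and \<open>t\<close> that is certainly
  a factor of \<open>\<omega>\<close>; the second block is left out for \<open>11\<close>, which is not a factor.\<close>

definition window :: "nat \<Rightarrow> bool \<Rightarrow> bool \<Rightarrow> bool list" where
  "window k s t = block k s @ (if s \<and> t then [] else block k t) @ common k"

lemma window_factors: "window k s t \<in> factors fib_omega"
proof -
  let ?a = "fib_word (Suc k)" and ?b = "fib_word k"
  \<comment> \<open>Read as abaababa; in it aa, ab, ba and b all occur followed by ab or ba, hence
    by \<open>common k\<close>.\<close>
  have w: "fib_word (k + 5) = ?a @ ?b @ ?a @ ?a @ ?b @ ?a @ ?b @ ?a"
    by (simp add: numeral_eq_Suc)
  note swap = fib_word_swap[of k, THEN conjunct1] fib_word_swap[of k, THEN conjunct2]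
  have "fib_word (k + 5) = (?a @ ?b) @ (?a @ ?a @ common k) @ ([odd k, even k] @ ?b @ ?a)"
    unfolding w using swap(2) by (metis append.assoc)
  then have aa: "?a @ ?a @ common k \<in> factors fib_omega" by (rule infix_factors)
  have "fib_word (k + 5) = (?a @ ?b @ ?a) @ (?a @ ?b @ common k) @ ([even k, odd k] @ ?a)"
    unfolding w using swap(1) by (metis append.assoc)
  then have ab: "?a @ ?b @ common k \<in> factors fib_omega" by (rule infix_factors)
  have "fib_word (k + 5) = ?a @ (?b @ ?a @ common k) @ ([even k, odd k] @ ?a @ ?b @ ?a)"
    unfolding w using swap(1) by (metis append.assoc)
  then have ba: "?b @ ?a @ common k \<in> factors fib_omega" by (rule infix_factors)
  have "fib_word (k + 5) = (?a @ ?b @ ?a @ ?a) @ (?b @ common k) @ ([even k, odd k] @ ?a)"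
    unfolding w using swap(1) by (metis append.assoc)
  then have b: "?b @ common k \<in> factors fib_omega" by (rule infix_factors)
  show ?thesis using aa ab ba b by (auto simp: window_def block_def)
qed

lemma fib_subst_window:
  assumes "0 < k"
  shows "\<exists>y. fib_subst k x = conc (window k (x 0) (shift x 0)) y"
proof (cases "x 0 \<and> shift x 0")
  case True
  obtain y where "fib_subst k (shift x) = conc (common k) y" using fib_subst_common[OF assms] by blast
  then show ?thesis
    using fib_subst_unfold[of k x] True by (auto simp: window_def conc_append)
next
  case False
  obtain y where "fib_subst k (shift (shift x)) = conc (common k) y" using fib_subst_common[OF assms] by blast
  then have "fib_subst k x = conc (window k (x 0) (shift x 0)) y"
    using fib_subst_unfold[of k x] fib_subst_unfold[of k "shift x"] False by (auto simp: window_def conc_append)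
  then show ?thesis by blast
qed

lemma delta_fib_subst_ge:
  assumes "0 < k" "j \<le> length (block k (x 0))"
  shows "enat (length (window k (x 0) (shift x 0)) - j) \<le> delta ((shift ^^ j) (fib_subst k x))"
proof -
  let ?w = "window k (x 0) (shift x 0)"
  obtain y where y: "fib_subst k x = conc ?w y" using fib_subst_window[OF assms(1)] by blast
  have "j \<le> length ?w" using assms(2) by (simp add: window_def)
  then show ?thesis
    using delta_ge[OF drop_factors[OF window_factors], of j k "x 0" "shift x 0" y]
    by (simp add: y funpow_shift_conc)
qed

text \<open>The shift removes whole blocks and then stops inside one, in front of another
  substituted sequence.\<close>

lemma fib_subst_recode: "\<exists>j s x'. j < length (block k s) \<and> (shift ^^ i) (fib_subst k x) = (shift ^^ j) (conc (block k s) (fib_subst k x'))"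
proof (induction i arbitrary: x rule: less_induct)
  case (less i)
  let ?l = "length (block k (x 0))"
  show ?case
  proof (cases "i < ?l")
    case True
    then show ?thesis using fib_subst_unfold[of k x] by metis
  next
    case False
    have "(shift ^^ i) (fib_subst k x) = (shift ^^ (?l + (i - ?l))) (conc (block k (x 0)) (fib_subst k (shift x)))"
      using fib_subst_unfold[of k x] False by simp
    also have "\<dots> = (shift ^^ (i - ?l)) (fib_subst k (shift x))"
      by (rule funpow_shift_conc_add)
    finally show ?thesis
      using less[of "i - ?l" "shift x"] length_block_pos[of k "x 0"] False by (metis diff_less leI order.strict_trans2)
  qed
qed

lemma fib_word_blocks: "\<exists>ts. fib_word (k + m) = concat (map (block k) ts)"
proof (induction m rule: fib_word.induct)
  case 1
  show ?case by (rule exI[of _ "[True]"]) (simp add: block_def)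
next
  case 2
  show ?case by (rule exI[of _ "[False]"]) (simp add: block_def)
next
  case (3 m)
  then obtain us vs where "fib_word (k + Suc m) = concat (map (block k) us)" "fib_word (k + m) = concat (map (block k) vs)"
    by blast
  then show ?case by (intro exI[of _ "us @ vs"]) simp
qed

text \<open>Such a factor is read from an offset in some block followed by \<open>common k\<close>,
  which is long enough to fill it. It is therefore determined by block and offset, for which there
  are \<open>Fibo k + Fibo (Suc k)\<close> choices.\<close>

lemma card_factors:
  assumes "0 < k"
  shows "finite {w \<in> factors fib_omega. length w = length (common k)}"
    and "card {w \<in> factors fib_omega. length w = length (common k)} \<le> Fibo (k + 2)"
proof -
  let ?c = "length (common k)"
  let ?W = "{w \<in> factors fib_omega. length w = ?c}"
  let ?I = "Sigma UNIV (\<lambda>s. {..<length (block k s)})"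
  have sub: "?W \<subseteq> (\<lambda>(s, j). take ?c (drop j (block k s) @ common k)) ` ?I"
  proof
    fix w assume "w \<in> ?W"
    then have len: "length w = ?c" and "w \<in> factors fib_omega" by simp_all
    then obtain i where i: "\<forall>l<?c. w ! l = fib_omega (i + l)"
      unfolding mem_factors_iff by metis
    \<comment> \<open>The occurrence ends after \<open>m\<close> letters of
      \<open>fib_omega\<close>, and \<open>fib_word (k + m)\<close>, a concatenation of blocks, is
      longer than that.\<close>
    define m where "m = i + ?c"
    obtain ts where ts: "fib_word (k + m) = concat (map (block k) ts)"
      using fib_word_blocks by blast
    define x where "x = conc ts (\<lambda>_. False)"
    have pre: "fib_subst k x l = fib_omega l" if "l < m" for l
    proof -
      have l: "l < length (fib_word (k + m))"
        using that less_Fibo[of "k + m"] by (simp add: length_fib_word)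
      then have "fib_subst k x l = fib_word (k + m) ! l"
        unfolding x_def fib_subst_conc ts[symmetric] by (simp add: conc_def)
      with l show ?thesis by (simp add: fib_word_nth)
    qed
    obtain j s x' where j: "j < length (block k s)" "(shift ^^ i) (fib_subst k x) = (shift ^^ j) (conc (block k s) (fib_subst k x'))"
      using fib_subst_recode by blast
    obtain y where y: "fib_subst k x' = conc (common k) y" using fib_subst_common[OF assms] by blast
    have "w = map ((shift ^^ i) (fib_subst k x)) [0..<?c]"
      using i len by (intro nth_equalityI) (auto simp: shift_funpow pre m_def)
    also have "\<dots> = take ?c (drop j (block k s) @ common k)"
      using j(1) by (simp add: j(2) y funpow_shift_conc map_upt_conc_cong flip: conc_append)
    finally show "w \<in> (\<lambda>(s, j). take ?c (drop j (block k s) @ common k)) ` ?I"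
      using j(1) by (intro image_eqI[of _ _ "(s, j)"]) auto
  qed
  have fin: "finite ?I" by (intro finite_SigmaI) auto
  show "finite ?W" using sub fin by (meson finite_imageI finite_subset)
  have "card ?W \<le> card ?I"
    by (rule order_trans[OF card_mono[OF finite_imageI[OF fin] sub] card_image_le[OF fin]])
  also have "\<dots> = Fibo (k + 2)"
    by (simp add: UNIV_bool length_block Fibo_simps)
  finally show "card ?W \<le> Fibo (k + 2)" .
qed

text \<open>Blocks are nonempty, so letter \<open>i\<close> of the image lies in one of the first
  \<open>i + 1\<close> blocks. Continuity of \<open>fib_subst k\<close> follows.\<close>

lemma fib_subst_cong_prefix: "(\<And>l. l \<le> i \<Longrightarrow> x l = y l) \<Longrightarrow> fib_subst k x i = fib_subst k y i"
proof (induction i arbitrary: x y rule: less_induct)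
  case (less i)
  have 0: "x 0 = y 0" using less.prems by simp
  show ?case
  proof (cases "i < length (block k (x 0))")
    case True
    then show ?thesis using 0 by (simp add: fib_subst.simps[of k x] fib_subst.simps[of k y])
  next
    case False
    have "fib_subst k (shift x) (i - length (block k (x 0))) = fib_subst k (shift y) (i - length (block k (x 0)))"
    proof (rule less.IH)
      have "0 < length (block k (x 0))" by (rule length_block_pos)
      then show "i - length (block k (x 0)) < i" using False by linarith
      fix l assume "l \<le> i - length (block k (x 0))"
      then have "Suc l \<le> i" using length_block_pos[of k "x 0"] False by linarith
      then show "shift x l = shift y l" using less.prems by (simp add: shift_def)
    qed
    then show ?thesis using 0 False by (simp add: fib_subst.simps[of k x] fib_subst.simps[of k y])
  qed
qed

lemma borel_measurable_fib_subst: "fib_subst k \<in> borel_measurable borel"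
proof (rule borel_measurable_continuous_onI)
  show "continuous_on UNIV (fib_subst k)"
    unfolding continuous_on_open_vimage[OF open_UNIV]
  proof (intro allI impI)
    fix U :: "point set" assume U: "open U"
    show "open (fib_subst k -` U \<inter> UNIV)"
      unfolding open_iff_prefix
    proof (intro ballI)
      fix x assume "x \<in> fib_subst k -` U \<inter> UNIV"
      then obtain n where n: "\<forall>y. (\<forall>i\<le>n. fib_subst k x i = y i) \<longrightarrow> y \<in> U"
        using U open_iff_prefix[of U] by auto
      show "\<exists>n. \<forall>y. (\<forall>i\<le>n. x i = y i) \<longrightarrow> y \<in> fib_subst k -` U \<inter> UNIV"
      proof (intro exI[of _ n] allI impI)
        fix y assume "\<forall>i\<le>n. x i = y i"
        then have "\<forall>i\<le>n. fib_subst k x i = fib_subst k y i"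
          by (intro allI impI fib_subst_cong_prefix) simp
        then show "y \<in> fib_subst k -` U \<inter> UNIV" using n by simp
      qed
    qed
  qed
qed

section \<open>Bernoulli sequences of blocks and their tower\<close>

text \<open>Serves to identify the product sigma-algebra of \<open>bern\<close> with the Borel sets,
  in \<open>sets_bern\<close>.\<close>

instance bool :: second_countable_topology
proof
  show "\<exists>B :: bool set set. countable B \<and> open = generate_topology B"
  proof (intro exI[of _ UNIV] conjI)
    show "open = generate_topology (UNIV :: bool set set)"
      by (auto simp: fun_eq_iff Topological_Spaces.open_discrete intro: generate_topology.Basis)
  qed (simp add: countable_finite)
qed

text \<open>Rational weights near the entropy-maximising ones, for which the weight of a block is
  exponential in minus its length; \<open>True\<close> stands for the shorter block.\<close>

definition prob_letter :: "bool \<Rightarrow> real" where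
  "prob_letter s = (if s then 4/7 else 3/7)"

definition bern :: "point measure" where
  "bern = (\<Pi>\<^sub>M i\<in>UNIV. measure_pmf (bernoulli_pmf (4/7)))"

lemma prob_letter: "0 < prob_letter s" "prob_letter True + prob_letter False = 1"
  by (simp_all add: prob_letter_def)

lemma sets_bern: "sets bern = sets borel"
proof -
  have "sets (measure_pmf (bernoulli_pmf (4/7))) = sets (borel :: bool measure)"
    using Topological_Spaces.open_discrete by (auto intro: borel_open)
  then have "sets bern = sets (\<Pi>\<^sub>M i\<in>(UNIV :: nat set). (borel :: bool measure))"
    unfolding bern_def by (intro sets_PiM_cong) auto
  then show ?thesis by (simp add: sets_PiM_equal_borel)
qed

lemma space_bern: "space bern = UNIV"
  using sets_eq_imp_space_eq[OF sets_bern] by simp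

interpretation bern: prob_space bern
  unfolding bern_def by (intro prob_space_PiM measure_pmf.prob_space_axioms)

lemma borel_measurable_conc: "conc [s] \<in> borel_measurable borel"
proof (intro borel_measurable_continuous_onI continuous_on_coordinatewise_then_product)
  fix i
  show "continuous_on UNIV (\<lambda>x. conc [s] x i)"
    by (cases i) (auto simp: conc_def intro: continuous_on_product_coordinates)
qed

lemma vimage_borel: "f \<in> borel_measurable borel \<Longrightarrow> A \<in> sets borel \<Longrightarrow> f -` A \<in> sets borel"
  using measurable_sets[of f borel borel A] by simp

text \<open>Independence as a recursion: prepending an independent letter to a sequence with law
  \<open>bern\<close> reproduces \<open>bern\<close>.\<close>

lemma measure_bern_first_letter:
  assumes A: "A \<in> sets borel"
  shows "measure bern A = (\<Sum>s\<in>UNIV. prob_letter s * measure bern (conc [s] -` A))"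
proof -
  interpret sequence_space "measure_pmf (bernoulli_pmf (4/7))"
    by unfold_locales
  let ?c = "measure_pmf (bernoulli_pmf (4/7))"
  have A': "A \<in> sets S" using A sets_bern by (simp add: bern_def)
  have eq: "case_nat s x = conc [s] x" for s :: bool and x
    by (auto simp: conc_def fun_eq_iff split: nat.split)
  have m: "(\<lambda>(s, \<omega>). case_nat s \<omega>) \<in> measurable (?c \<Otimes>\<^sub>M S) S"
    by measurable
  have "emeasure bern A = emeasure (distr (?c \<Otimes>\<^sub>M S) S (\<lambda>(s, \<omega>). case_nat s \<omega>)) A"
    by (simp add: PiM_iter bern_def)
  also have "\<dots> = emeasure (?c \<Otimes>\<^sub>M S) ((\<lambda>(s, \<omega>). case_nat s \<omega>) -` A \<inter> space (?c \<Otimes>\<^sub>M S))"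
    by (rule emeasure_distr[OF m A'])
  also have "\<dots> = (\<integral>\<^sup>+s. emeasure S (Pair s -` ((\<lambda>(s, \<omega>). case_nat s \<omega>) -` A \<inter> space (?c \<Otimes>\<^sub>M S))) \<partial>?c)"
    by (rule P.emeasure_pair_measure_alt) (rule measurable_sets[OF m A'])
  also have "\<dots> = (\<integral>\<^sup>+s. emeasure bern (conc [s] -` A) \<partial>?c)"
    using space_bern by (intro nn_integral_cong arg_cong2[where f = emeasure])
      (auto simp: bern_def space_pair_measure eq)
  also have "\<dots> = (\<Sum>s\<in>UNIV. ennreal (prob_letter s) * emeasure bern (conc [s] -` A))"
    by (simp add: nn_integral_measure_pmf nn_integral_count_space_finite UNIV_bool prob_letter_def mult.commute)
  also have "\<dots> = ennreal (\<Sum>s\<in>UNIV. prob_letter s * measure bern (conc [s] -` A))"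
    using prob_letter(1) by (simp add: bern.emeasure_eq_measure UNIV_bool ennreal_mult less_imp_le)
  finally show ?thesis
    using prob_letter(1) by (simp add: bern.emeasure_eq_measure sum_nonneg less_imp_le)
qed

lemma measure_bern_letter: "measure bern {x. x 0 = t} = prob_letter t"
proof -
  have "{x :: point. x 0 = t} = {y. \<forall>k\<le>0. (\<lambda>_. t) k = y k}" by auto
  then have "open {x :: point. x 0 = t}" using open_prefix[of 0 "\<lambda>_. t"] by simp
  moreover have "conc [s] -` {x. x 0 = t} = (if s = t then UNIV else {})" for s by auto
  moreover have "measure bern UNIV = 1" using bern.prob_space by (simp add: space_bern)
  ultimately show ?thesis
    by (subst measure_bern_first_letter) (simp_all add: UNIV_bool)
qed

section \<open>The tower over the Bernoulli sequences\<close>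

definition tower_index :: "nat \<Rightarrow> (bool \<times> nat) set" where
  "tower_index k = Sigma UNIV (\<lambda>s. {..<length (block k s)})"

definition mean_length :: "nat \<Rightarrow> real" where
  "mean_length k = (\<Sum>s\<in>UNIV. prob_letter s * length (block k s))"

text \<open>The block over the origin is chosen with probability proportional to weight times
  length, and the offset in it uniformly.\<close>

definition tower_weight :: "nat \<Rightarrow> bool \<times> nat \<Rightarrow> real" where
  "tower_weight k d = (if d \<in> tower_index k then prob_letter (fst d) / mean_length k else 0)"

definition tower_point :: "nat \<Rightarrow> bool \<times> nat \<Rightarrow> point \<Rightarrow> point" where
  "tower_point k d x = (shift ^^ snd d) (fib_subst k (conc [fst d] x))"

definition tower_pmf :: "nat \<Rightarrow> (bool \<times> nat) pmf" where
  "tower_pmf k = embed_pmf (tower_weight k)"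

definition tower :: "nat \<Rightarrow> point measure" where
  "tower k = distr (measure_pmf (tower_pmf k) \<Otimes>\<^sub>M bern) borel (\<lambda>(d, x). tower_point k d x)"

lemma finite_tower_index: "finite (tower_index k)"
  unfolding tower_index_def by (intro finite_SigmaI) auto

lemma sum_tower_index: "(\<Sum>d\<in>tower_index k. f d) = (\<Sum>s\<in>UNIV. \<Sum>j<length (block k s). f (s, j))"
  unfolding tower_index_def by (simp add: sum.Sigma)

lemma mean_length_pos: "0 < mean_length k"
  unfolding mean_length_def using prob_letter(1) length_block_pos
  by (intro sum_pos) simp_all

lemma tower_weight_nonneg: "0 \<le> tower_weight k d"
  using mean_length_pos[of k] prob_letter(1) by (simp add: tower_weight_def less_imp_le)

lemma sum_tower_weight: "(\<Sum>d\<in>tower_index k. tower_weight k d) = 1"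
proof -
  have "(\<Sum>d\<in>tower_index k. tower_weight k d) = (\<Sum>d\<in>tower_index k. prob_letter (fst d) / mean_length k)"
    by (simp add: tower_weight_def)
  also have "\<dots> = (\<Sum>s\<in>UNIV. prob_letter s * length (block k s)) / mean_length k"
    unfolding sum_tower_index by (simp add: sum_divide_distrib mult.commute)
  finally show ?thesis using mean_length_pos[of k] by (simp add: mean_length_def)
qed

lemma pmf_tower: "pmf (tower_pmf k) d = tower_weight k d"
  unfolding tower_pmf_def
proof (rule pmf_embed_pmf)
  have "(\<integral>\<^sup>+d. ennreal (tower_weight k d) \<partial>count_space UNIV) = (\<Sum>d\<in>tower_index k. ennreal (tower_weight k d))"
    by (rule nn_integral_count_space'[OF finite_tower_index]) (auto simp: tower_weight_def)
  also have "\<dots> = ennreal (\<Sum>d\<in>tower_index k. tower_weight k d)"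
    by (intro sum_ennreal tower_weight_nonneg)
  finally show "(\<integral>\<^sup>+d. ennreal (tower_weight k d) \<partial>count_space UNIV) = 1"
    by (simp add: sum_tower_weight)
qed (rule tower_weight_nonneg)

lemma set_tower_pmf: "set_pmf (tower_pmf k) = tower_index k"
  using mean_length_pos[of k] prob_letter(1)
  by (auto simp: set_pmf_eq pmf_tower tower_weight_def less_le)

lemma borel_measurable_shift_funpow: "(shift ^^ j) \<in> borel_measurable borel"
proof (induction j)
  case (Suc j)
  show ?case
    unfolding funpow.simps by (rule measurable_comp[OF Suc borel_measurable_shift])
qed simp

lemma borel_measurable_tower_point: "tower_point k d \<in> borel_measurable borel"
proof -
  have "tower_point k d = (shift ^^ snd d) \<circ> (fib_subst k \<circ> conc [fst d])"
    by (simp add: tower_point_def fun_eq_iff)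
  moreover have "\<dots> \<in> borel_measurable borel"
    by (intro measurable_comp[of _ borel borel] borel_measurable_shift_funpow borel_measurable_fib_subst borel_measurable_conc)
  ultimately show ?thesis by simp
qed

lemma measurable_tower: "(\<lambda>(d, x). tower_point k d x) \<in> measurable (measure_pmf (tower_pmf k) \<Otimes>\<^sub>M bern) borel"
proof -
  have "(\<lambda>(d, x). tower_point k d x) \<in> measurable (count_space UNIV \<Otimes>\<^sub>M borel) borel"
    by (rule measurable_pair_measure_countable1) (simp_all add: borel_measurable_tower_point)
  moreover have "sets (measure_pmf (tower_pmf k) \<Otimes>\<^sub>M bern) = sets (count_space UNIV \<Otimes>\<^sub>M borel)"
    by (intro sets_pair_measure_cong) (simp_all add: sets_bern)
  ultimately show ?thesis by (simp cong: measurable_cong_sets)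
qed

lemma pair_prob_space_tower: "pair_prob_space (measure_pmf (tower_pmf k)) bern"
  by unfold_locales

lemma prob_space_tower: "prob_space (tower k)"
proof -
  interpret pair_prob_space "measure_pmf (tower_pmf k)" bern by (rule pair_prob_space_tower)
  show ?thesis unfolding tower_def by (rule prob_space_distr[OF measurable_tower])
qed

lemma sets_tower: "sets (tower k) = sets borel"
  by (simp add: tower_def)

lemma measure_tower:
  assumes A: "A \<in> sets borel"
  shows "measure (tower k) A = (\<Sum>d\<in>tower_index k. tower_weight k d * measure bern (tower_point k d -` A))"
proof -
  let ?D = "measure_pmf (tower_pmf k)"
  interpret pair_prob_space ?D bern by (rule pair_prob_space_tower)
  interpret T: prob_space "tower k" by (rule prob_space_tower)
  let ?f = "\<lambda>(d, x). tower_point k d x"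
  have "emeasure (tower k) A = emeasure (?D \<Otimes>\<^sub>M bern) (?f -` A \<inter> space (?D \<Otimes>\<^sub>M bern))"
    unfolding tower_def by (rule emeasure_distr[OF measurable_tower A])
  also have "\<dots> = (\<integral>\<^sup>+d. emeasure bern (Pair d -` (?f -` A \<inter> space (?D \<Otimes>\<^sub>M bern))) \<partial>?D)"
    by (rule bern.emeasure_pair_measure_alt) (rule measurable_sets[OF measurable_tower A])
  also have "\<dots> = (\<integral>\<^sup>+d. emeasure bern (tower_point k d -` A) \<partial>?D)"
    by (intro nn_integral_cong arg_cong2[where f = emeasure]) (auto simp: space_pair_measure space_bern)
  also have "\<dots> = (\<Sum>d\<in>tower_index k. emeasure bern (tower_point k d -` A) * ennreal (tower_weight k d))"
    by (subst nn_integral_measure_pmf_finite) (simp_all add: set_tower_pmf finite_tower_index pmf_tower)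
  also have "\<dots> = (\<Sum>d\<in>tower_index k. ennreal (tower_weight k d * measure bern (tower_point k d -` A)))"
    by (intro sum.cong refl) (simp add: bern.emeasure_eq_measure ennreal_mult tower_weight_nonneg mult.commute)
  also have "\<dots> = ennreal (\<Sum>d\<in>tower_index k. tower_weight k d * measure bern (tower_point k d -` A))"
    by (intro sum_ennreal mult_nonneg_nonneg tower_weight_nonneg measure_nonneg)
  finally show ?thesis
    by (simp add: T.emeasure_eq_measure sum_nonneg tower_weight_nonneg)
qed

lemma measure_tower':
  assumes A: "A \<in> sets borel"
  shows "measure (tower k) A =
    (\<Sum>s\<in>UNIV. prob_letter s * (\<Sum>j<length (block k s). measure bern (tower_point k (s, j) -` A))) / mean_length k"
proof -
  have "measure (tower k) A = (\<Sum>d\<in>tower_index k. prob_letter (fst d) * measure bern (tower_point k d -` A) / mean_length k)"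
    unfolding measure_tower[OF A] by (intro sum.cong) (simp_all add: tower_weight_def)
  then show ?thesis
    unfolding sum_tower_index by (simp add: sum_distrib_left sum_divide_distrib)
qed

text \<open>The shift moves offset \<open>j\<close> to \<open>j + 1\<close>, so the difference of
  the two measures telescopes to tops minus bottoms of the columns. Averaged over the letters, both
  are the law of \<open>fib_subst k\<close> under \<open>bern\<close>.\<close>

lemma shift_invariant_tower: "shift_invariant (tower k)"
proof -
  interpret T: prob_space "tower k" by (rule prob_space_tower)
  have ms: "shift \<in> measurable (tower k) (tower k)"
    using borel_measurable_shift measurable_cong_sets[OF sets_tower sets_tower] by blast
  have inv: "measure (tower k) (shift -` A) = measure (tower k) A" if A: "A \<in> sets borel" for A
  proof -
    define m where "m s j = measure bern (tower_point k (s, j) -` A)" for s j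
    have sA: "shift -` A \<in> sets borel" using borel_measurable_shift A by (rule vimage_borel)
    have step: "tower_point k (s, j) -` (shift -` A) = tower_point k (s, Suc j) -` A" for s j
      by (auto simp: tower_point_def)
    \<comment> \<open>Past its last letter the first block is gone, whatever \<open>s\<close>
      was.\<close>
    have top: "m s (length (block k s)) = measure bern (fib_subst k -` A)" for s
    proof -
      have "tower_point k (s, length (block k s)) x = fib_subst k x" for x
        using funpow_shift_conc_add[of "block k s" 0] fib_subst_unfold[of k "conc [s] x"]
        by (simp add: tower_point_def)
      then show ?thesis by (simp add: m_def vimage_def)
    qed
    have bottom: "(\<Sum>s\<in>UNIV. prob_letter s * m s 0) = measure bern (fib_subst k -` A)"
      unfolding measure_bern_first_letter[OF vimage_borel[OF borel_measurable_fib_subst A]]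
      by (simp add: m_def tower_point_def vimage_def)
    have "(\<Sum>s\<in>UNIV. prob_letter s * (\<Sum>j<length (block k s). m s (Suc j)))
        - (\<Sum>s\<in>UNIV. prob_letter s * (\<Sum>j<length (block k s). m s j))
        = (\<Sum>s\<in>UNIV. prob_letter s * (\<Sum>j<length (block k s). m s (Suc j) - m s j))"
      by (simp add: sum_subtractf right_diff_distrib)
    also have "\<dots> = (\<Sum>s\<in>UNIV. prob_letter s * (measure bern (fib_subst k -` A) - m s 0))"
      by (simp only: sum_lessThan_telescope top)
    also have "\<dots> = 0"
    proof -
      let ?b = "measure bern (fib_subst k -` A)"
      have "(\<Sum>s\<in>UNIV. prob_letter s * (?b - m s 0)) = (prob_letter True + prob_letter False) * ?b
          - (\<Sum>s\<in>UNIV. prob_letter s * m s 0)"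
        by (simp add: UNIV_bool algebra_simps)
      then show ?thesis using bottom prob_letter(2) by simp
    qed
    finally show ?thesis
      unfolding measure_tower'[OF A] measure_tower'[OF sA] step m_def[symmetric] by simp
  qed
  show ?thesis
  proof
    show "sets (tower k) = sets borel" by (rule sets_tower)
    show "distr (tower k) (tower k) shift = tower k"
    proof (rule measure_eqI)
      fix A assume "A \<in> sets (distr (tower k) (tower k) shift)"
      then have A: "A \<in> sets (tower k)" by simp
      have "space (tower k) = UNIV" by (simp add: tower_def)
      then show "emeasure (distr (tower k) (tower k) shift) A = emeasure (tower k) A"
        using inv[of A] A by (simp add: emeasure_distr[OF ms A] T.emeasure_eq_measure sets_tower)
    qed simp
  qed
qed

text \<open>The letter of \<open>w\<close> at position \<open>length (common k)\<close> determines
  the first block. Its probability supplies one exponential factor, and removing the block leaves a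
  shorter cylinder. Below length \<open>Fibo (k + 2)\<close> the bound is at least 1.\<close>

lemma measure_bern_cylinder_le:
  fixes \<sigma> :: real
  assumes k: "0 < k" and \<sigma>: "0 \<le> \<sigma>" "\<And>s. prob_letter s \<le> exp (- (\<sigma> * length (block k s)))"
  shows "measure bern {x. map (fib_subst k x) [0..<n] = w} \<le> exp (- (\<sigma> * (real n - Fibo (k + 2))))"
proof (induction n arbitrary: w rule: less_induct)
  case (less n)
  let ?F = "Fibo (k + 2)"
  show ?case
  proof (cases "n < ?F")
    case True
    have "measure bern {x. map (fib_subst k x) [0..<n] = w} \<le> 1" by simp
    also have "1 \<le> exp (- (\<sigma> * (real n - ?F)))"
      using True \<sigma>(1) by (simp add: mult_nonneg_nonpos)
    finally show ?thesis .
  next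
    case False
    let ?A = "{x. map (fib_subst k x) [0..<n] = w}"
    have idx: "length (common k) < n" using False length_common[of k] by linarith
    have "?A = fib_subst k -` {y. map y [0..<n] = w}" by auto
    moreover have "open {y :: point. map y [0..<n] = w}"
      unfolding open_iff_prefix by (auto intro!: exI[of _ n] cong: map_cong)
    ultimately have A: "?A \<in> sets borel"
      using vimage_borel[OF borel_measurable_fib_subst, OF borel_open] by metis
    have meas: "measure bern (conc [s] -` ?A) \<le> exp (- (\<sigma> * (real n - length (block k s) - ?F)))" for s
    proof -
      have l: "length (block k s) \<le> n" "0 < length (block k s)"
        using False length_block_pos[of k s] by (auto simp: length_block Fibo_simps split: if_splits)
      have "conc [s] -` ?A \<subseteq> {x. map (fib_subst k x) [0..<n - length (block k s)] = drop (length (block k s)) w}"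
      proof
        fix x assume "x \<in> conc [s] -` ?A"
        then have w: "w = map (conc (block k s) (fib_subst k x)) [0..<n]"
          using fib_subst_conc[of k "[s]" x] by auto
        have "map (fib_subst k x) [0..<n - length (block k s)] = drop (length (block k s)) w"
          unfolding w by (rule nth_equalityI) (auto simp: conc_def)
        then show "x \<in> {x. map (fib_subst k x) [0..<n - length (block k s)] = drop (length (block k s)) w}"
          by simp
      qed
      then have "measure bern (conc [s] -` ?A)
          \<le> measure bern {x. map (fib_subst k x) [0..<n - length (block k s)] = drop (length (block k s)) w}"
      proof (rule bern.finite_measure_mono)
        have "open {y :: point. map y [0..<n'] = w'}" for n' w'
          unfolding open_iff_prefix by (auto intro!: exI[of _ n'] cong: map_cong)
        from vimage_borel[OF borel_measurable_fib_subst borel_open[OF this]]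
        show "{x. map (fib_subst k x) [0..<n - length (block k s)] = drop (length (block k s)) w} \<in> sets bern"
          by (simp add: sets_bern vimage_def)
      qed
      also have "\<dots> \<le> exp (- (\<sigma> * (real (n - length (block k s)) - ?F)))"
        using l by (intro less) linarith
      finally show ?thesis using l by (simp add: of_nat_diff)
    qed
    \<comment> \<open>The first letter decoded from \<open>w\<close> by
      \<open>fib_subst_letter\<close>; the other branch is empty.\<close>
    define t where "t = (even k \<noteq> (w ! length (common k)))"
    have other: "conc [s] -` ?A = {}" if "s \<noteq> t" for s
    proof -
      have False if "x \<in> conc [s] -` ?A" for x
      proof -
        have "w ! length (common k) = fib_subst k (conc [s] x) (length (common k))"
          using that idx by auto
        also have "\<dots> = (even k \<noteq> s)"
          by (subst fib_subst_letter[OF k]) simp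
        finally show False using \<open>s \<noteq> t\<close> by (auto simp: t_def)
      qed
      then show ?thesis by blast
    qed
    have "measure bern ?A = prob_letter t * measure bern (conc [t] -` ?A)"
      unfolding measure_bern_first_letter[OF A]
      using other[of "\<not> t"] by (cases t) (simp_all add: UNIV_bool)
    also have "\<dots> \<le> exp (- (\<sigma> * length (block k t))) * exp (- (\<sigma> * (real n - length (block k t) - ?F)))"
      by (intro mult_mono \<sigma> meas) simp_all
    also have "\<dots> = exp (- (\<sigma> * (real n - ?F)))"
      by (simp add: exp_add[symmetric] algebra_simps)
    finally show ?thesis .
  qed
qed

text \<open>On each level, deleting the rest of the first block leaves a cylinder for the
  substituted sequence. Both losses, of at most \<open>Fibo (k + 2)\<close> letters each, are
  independent of \<open>n\<close>, so \<open>ent_ge\<close> yields the rate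
  \<open>\<sigma>\<close>.\<close>

lemma tower_entropy_ge:
  fixes \<sigma> :: real
  assumes k: "0 < k" and \<sigma>: "0 \<le> \<sigma>" "\<And>s. prob_letter s \<le> exp (- (\<sigma> * length (block k s)))"
  shows "ereal \<sigma> \<le> kolmogorov_entropy (tower k) shift"
proof -
  interpret shift_invariant "tower k" by (rule shift_invariant_tower)
  let ?F = "real (Fibo (k + 2))"
  have op: "open {y :: point. map y [0..<n] = w}" for n w
    unfolding open_iff_prefix by (auto intro!: exI[of _ n] cong: map_cong)
  have cyl: "measure (tower k) {y. map y [0..<n] = w} \<le> exp (- (\<sigma> * (real n - 2 * ?F)))" for n w
  proof -
    have le: "measure bern (tower_point k d -` {y. map y [0..<n] = w}) \<le> exp (- (\<sigma> * (real n - 2 * ?F)))"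
      if d: "d \<in> tower_index k" for d
    proof -
      obtain s j where sj: "d = (s, j)" "j < length (block k s)"
        using d by (auto simp: tower_index_def)
      define l where "l = length (block k s) - j"
      have lF: "real l \<le> ?F"
        unfolding l_def by (auto simp: length_block Fibo_simps)
      have "tower_point k d -` {y. map y [0..<n] = w} \<subseteq> {x. map (fib_subst k x) [0..<n - l] = drop l w}"
      proof
        fix x assume "x \<in> tower_point k d -` {y. map y [0..<n] = w}"
        then have w: "w = map (conc (drop j (block k s)) (fib_subst k x)) [0..<n]"
          using fib_subst_conc[of k "[s]" x] sj by (auto simp: tower_point_def funpow_shift_conc)
        have "map (fib_subst k x) [0..<n - l] = drop l w"
          unfolding w by (rule nth_equalityI) (auto simp: conc_def l_def)
        then show "x \<in> {x. map (fib_subst k x) [0..<n - l] = drop l w}" by simp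
      qed
      then have "measure bern (tower_point k d -` {y. map y [0..<n] = w})
          \<le> measure bern {x. map (fib_subst k x) [0..<n - l] = drop l w}"
      proof (rule bern.finite_measure_mono)
        from vimage_borel[OF borel_measurable_fib_subst borel_open[OF op]]
        show "{x. map (fib_subst k x) [0..<n - l] = drop l w} \<in> sets bern"
          by (simp add: sets_bern vimage_def)
      qed
      also have "\<dots> \<le> exp (- (\<sigma> * (real (n - l) - ?F)))"
        by (rule measure_bern_cylinder_le[OF k \<sigma>])
      also have "\<dots> \<le> exp (- (\<sigma> * (real n - 2 * ?F)))"
        using lF \<sigma>(1) by (simp add: mult_left_mono)
      finally show ?thesis .
    qed
    have "measure (tower k) {y. map y [0..<n] = w}
        \<le> (\<Sum>d\<in>tower_index k. tower_weight k d * exp (- (\<sigma> * (real n - 2 * ?F))))"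
      unfolding measure_tower[OF borel_open[OF op]]
      by (intro sum_mono mult_left_mono le tower_weight_nonneg)
    also have "\<dots> = exp (- (\<sigma> * (real n - 2 * ?F)))"
      by (simp add: sum_distrib_right[symmetric] sum_tower_weight)
    finally show ?thesis .
  qed
  show ?thesis
  proof (rule kolmogorov_entropy_ge)
    fix n
    have "\<sigma> * (real n - 2 * ?F) \<le> ent (tower k) (name (\<lambda>x. x 0) n)"
    proof (rule ent_ge)
      show "simple_function (tower k) (name (\<lambda>x. x 0) n)"
        by (intro simple_function_name simple_function_letter)
      fix w
      have "name (\<lambda>x. x 0) n -` {w} \<inter> space (tower k) = {y. map y [0..<n] = w}"
        by (auto simp: name_letter space_UNIV)
      then show "measure (tower k) (name (\<lambda>x. x 0) n -` {w} \<inter> space (tower k)) \<le> exp (- (\<sigma> * (real n - 2 * ?F)))"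
        using cyl by simp
    qed
    then show "real n * \<sigma> - \<sigma> * (2 * ?F) \<le> ent (tower k) (name (\<lambda>x. x 0) n)"
      by (simp add: algebra_simps)
  qed
qed

section \<open>The potential along the tower\<close>

text \<open>Prefixes of factors are factors, so a failure at \<open>n\<close> caps the supremum at
  \<open>n - 1\<close>.\<close>

lemma delta_ge_iff: "enat n \<le> delta x \<longleftrightarrow> map x [0..<n] \<in> factors fib_omega"
proof
  let ?S = "{n. map x [0..<n] \<in> factors fib_omega}"
  show "map x [0..<n] \<in> factors fib_omega \<Longrightarrow> enat n \<le> delta x"
    unfolding delta_def by (intro SUP_upper) simp
  assume le: "enat n \<le> delta x"
  show "map x [0..<n] \<in> factors fib_omega"
  proof (rule ccontr)
    assume no: "map x [0..<n] \<notin> factors fib_omega"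
    moreover have "map x [0..<0] \<in> factors fib_omega"
      unfolding prefix_in_factors_iff by simp
    ultimately have "0 < n" by (metis gr0I)
    have "m < n" if "m \<in> ?S" for m
    proof (rule ccontr)
      assume "\<not> m < n"
      then show False
        using that no unfolding prefix_in_factors_iff mem_Collect_eq by (meson leI less_le_trans)
    qed
    then have "delta x \<le> enat (n - 1)"
      unfolding delta_def by (intro SUP_least) fastforce
    then have "enat n \<le> enat (n - 1)" using le by (rule order_trans[rotated])
    then show False using \<open>0 < n\<close> by simp
  qed
qed

text \<open>Keeps the potential clear of a division by 0, whatever \<open>N\<close> is.\<close>

lemma delta_ge_1: "1 \<le> delta x"
proof -
  have "[False] \<in> factors fib_omega" by (rule infix_factors[of 0 "[]" _ "[]"]) simp
  moreover have "[True] \<in> factors fib_omega" by (rule infix_factors[of "Suc 0" "[False]" _ "[]"]) simp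
  ultimately have "map x [0..<1] \<in> factors fib_omega" by (cases "x 0") simp_all
  then show ?thesis using delta_ge_iff[of 1 x] by (simp add: one_enat_def)
qed

lemma measurable_delta: "delta \<in> measurable borel (count_space UNIV)"
proof -
  have ge: "{x. enat n \<le> delta x} \<in> sets borel" for n
  proof -
    have "open {x :: point. map x [0..<n] \<in> factors fib_omega}"
      unfolding open_iff_prefix
    proof (intro ballI exI[of _ n] allI impI)
      fix x y :: point assume "x \<in> {x. map x [0..<n] \<in> factors fib_omega}" "\<forall>k\<le>n. x k = y k"
      moreover from this(2) have "map x [0..<n] = map y [0..<n]" by simp
      ultimately show "y \<in> {x. map x [0..<n] \<in> factors fib_omega}" by simp
    qed
    then show ?thesis by (simp add: delta_ge_iff)
  qed
  have "delta -` {d} \<in> sets borel" for d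
  proof (cases d)
    case (enat n)
    have "delta -` {d} = {x. enat n \<le> delta x} - {x. enat (Suc n) \<le> delta x}"
    proof (intro set_eqI)
      fix x show "x \<in> delta -` {d} \<longleftrightarrow> x \<in> {x. enat n \<le> delta x} - {x. enat (Suc n) \<le> delta x}"
        using enat by (cases "delta x") auto
    qed
    then show ?thesis using ge by simp
  next
    case infinity
    have "delta -` {d} = (\<Inter>n. {x. enat n \<le> delta x})"
    proof (intro equalityI subsetI)
      fix x assume "x \<in> (\<Inter>n. {x. enat n \<le> delta x})"
      then have "delta x \<noteq> enat n" for n using Suc_ile_eq[of n "delta x"] by auto
      then show "x \<in> delta -` {d}" using infinity by (simp add: not_infinity_eq[symmetric]) blast
    qed (use infinity in auto)
    then show ?thesis using ge by simp
  qed
  then show ?thesis by (simp add: measurable_count_space_eq2_countable)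
qed

lemma borel_measurable_potential: "potential N A \<in> borel_measurable borel"
proof -
  define h where "h d = (if enat N \<le> d then (case d of enat k \<Rightarrow> - ln (1 + 1 / real k) | \<infinity> \<Rightarrow> 0) else - A)" for d
  have "h \<in> borel_measurable (count_space UNIV)" by simp
  then have "(\<lambda>x. h (delta x)) \<in> borel_measurable borel"
    by (rule measurable_compose[OF measurable_delta])
  then show ?thesis by (simp add: h_def potential_def[abs_def])
qed

lemma ln_one_plus_inverse:
  assumes "1 \<le> n"
  shows "0 < ln (1 + 1 / real n)" "ln (1 + 1 / real n) \<le> 1"
proof -
  show "0 < ln (1 + 1 / real n)" by (rule ln_gt_zero) (use assms in simp)
  have "ln (1 + 1 / real n) \<le> 1 / real n" by (rule ln_add_one_self_le_self) simp
  also have "\<dots> \<le> 1" using assms by simp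
  finally show "ln (1 + 1 / real n) \<le> 1" .
qed

lemma potential_nonpos: "0 < A \<Longrightarrow> potential N A x \<le> 0"
  using ln_one_plus_inverse(1) delta_ge_1[of x]
  by (auto simp: potential_def one_enat_def less_imp_le split: enat.split)

lemma potential_eq_0: "0 < A \<Longrightarrow> potential N A x = 0 \<Longrightarrow> delta x = \<infinity>"
  using ln_one_plus_inverse(1) delta_ge_1[of x]
  by (force simp: potential_def one_enat_def split: enat.split_asm if_splits)

lemma potential_ge_bound: "0 < A \<Longrightarrow> - (max A 1) \<le> potential N A x"
  using ln_one_plus_inverse(2) delta_ge_1[of x]
  by (auto simp: potential_def one_enat_def le_max_iff_disj split: enat.split)

lemma potential_ge:
  assumes "enat n \<le> delta x" "N \<le> n" "1 \<le> n"
  shows "- ln (1 + 1 / real n) \<le> potential N A x"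
proof -
  have "enat N \<le> delta x" using assms by (meson enat_ord_simps(1) order_trans)
  moreover have "ln (1 + 1 / real m) \<le> ln (1 + 1 / real n)" if "n \<le> m" for m
    using that assms(3) by (subst ln_le_cancel_iff) (auto simp: field_simps add_pos_nonneg)
  ultimately show ?thesis
    using assms(1,3) ln_one_plus_inverse(1)[OF assms(3)]
    by (auto simp: potential_def less_imp_le split: enat.split)
qed

section \<open>Integrals of the potential over the tower\<close>

lemma integrable_potential:
  assumes "prob_space M" "sets M = sets borel" "0 < A"
  shows "integrable M (potential N A)"
proof -
  interpret prob_space M by fact
  show ?thesis
  proof (rule integrable_const_bound[of _ "max A 1"])
    show "AE x in M. norm (potential N A x) \<le> max A 1"
      using potential_nonpos[OF assms(3)] potential_ge_bound[OF assms(3)]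
      by (intro always_eventually allI) (simp add: abs_le_iff minus_le_iff order_trans[of _ 0])
    show "potential N A \<in> borel_measurable M"
      using borel_measurable_potential assms(2) by (simp cong: measurable_cong_sets)
  qed
qed

lemma integrable_potential_comp:
  assumes "f \<in> borel_measurable borel" "0 < A"
  shows "integrable bern (\<lambda>x. potential N A (f x))"
proof (rule bern.integrable_const_bound[of _ "max A 1"])
  show "AE x in bern. norm (potential N A (f x)) \<le> max A 1"
    using potential_nonpos[OF assms(2)] potential_ge_bound[OF assms(2)]
    by (intro always_eventually allI) (simp add: abs_le_iff minus_le_iff order_trans[of _ 0])
  have "f \<in> measurable bern borel" using assms(1) sets_bern by (simp cong: measurable_cong_sets)
  then show "(\<lambda>x. potential N A (f x)) \<in> borel_measurable bern"
    using borel_measurable_potential by (rule measurable_compose)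
qed

text \<open>The closed form, by \<open>sum_ln_telescope\<close>, of the sum of
  \<open>ln (1 + 1 / (W - j))\<close> over the offsets \<open>j\<close> in the block of
  \<open>s\<close>, with \<open>W\<close> the length of the window. It bounds minus the potential
  summed along that block when the next letter is \<open>t\<close>.\<close>

definition cost :: "nat \<Rightarrow> bool \<Rightarrow> bool \<Rightarrow> real" where
  "cost k s t = ln ((real (length (window k s t)) + 1) / (real (length (window k s t)) + 1 - length (block k s)))"

lemma sum_ln_telescope:
  assumes "L < W"
  shows "(\<Sum>j<L. ln (1 + 1 / real (W - j))) = ln ((real W + 1) / (real W + 1 - L))"
  using assms
proof (induction L)
  case (Suc L)
  have W: "real (W - L) = real W - L" "0 < real W - L" using Suc.prems by (auto simp: of_nat_diff)
  have "1 + 1 / real (W - L) = (real W + 1 - L) / (real W - L)"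
    using W by (simp add: field_simps)
  then have "(\<Sum>j<Suc L. ln (1 + 1 / real (W - j))) =
      ln ((real W + 1) / (real W + 1 - L)) + ln ((real W + 1 - L) / (real W - L))"
    using Suc by simp
  also have "\<dots> = ln ((real W + 1) / (real W + 1 - L) * ((real W + 1 - L) / (real W - L)))"
    using W by (intro ln_mult_pos[symmetric]) (auto intro!: divide_pos_pos)
  also have "(real W + 1) / (real W + 1 - L) * ((real W + 1 - L) / (real W - L)) = (real W + 1) / (real W + 1 - Suc L)"
    using W by simp
  finally show ?case .
qed simp

lemma integral_tower:
  assumes A: "0 < A"
  shows "(\<integral>y. potential N A y \<partial>tower k) =
    (\<Sum>d\<in>tower_index k. tower_weight k d * (\<integral>x. potential N A (tower_point k d x) \<partial>bern))"
proof -
  let ?D = "measure_pmf (tower_pmf k)"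
  interpret P: pair_prob_space ?D bern by (rule pair_prob_space_tower)
  have m: "potential N A \<in> borel_measurable borel" by (rule borel_measurable_potential)
  have int: "integrable (?D \<Otimes>\<^sub>M bern) (\<lambda>(d, x). potential N A (tower_point k d x))"
    using integrable_potential[OF prob_space_tower sets_tower A, of k N]
      integrable_distr_eq[OF measurable_tower m]
    unfolding tower_def by (simp add: case_prod_beta')
  have "(\<integral>y. potential N A y \<partial>tower k) = (\<integral>z. potential N A ((\<lambda>(d, x). tower_point k d x) z) \<partial>(?D \<Otimes>\<^sub>M bern))"
    unfolding tower_def by (rule integral_distr[OF measurable_tower m])
  also have "\<dots> = (\<integral>d. \<integral>x. potential N A (tower_point k d x) \<partial>bern \<partial>?D)"
    using P.integral_fst'[OF int] by (simp add: case_prod_beta')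
  also have "\<dots> = (\<Sum>d\<in>tower_index k. (\<integral>x. potential N A (tower_point k d x) \<partial>bern) * pmf (tower_pmf k) d)"
    by (rule integral_measure_pmf_real[OF finite_tower_index]) (simp add: set_tower_pmf)
  finally show ?thesis by (simp add: pmf_tower mult.commute)
qed

text \<open>The first letter of \<open>x\<close> follows \<open>s\<close> and so selects the window;
  \<open>?g\<close> is the resulting bound. The window reaches beyond the block by at least
  \<open>common k\<close>, so \<open>delta\<close> is at least \<open>N\<close> and the value
  \<open>- A\<close> does not occur.\<close>

lemma integral_tower_point_ge:
  assumes A: "0 < A" and k: "0 < k" and N: "N \<le> length (common k)" and j: "j < length (block k s)"
  shows "- (\<Sum>t\<in>UNIV. prob_letter t * ln (1 + 1 / real (length (window k s t) - j)))
    \<le> (\<integral>x. potential N A (tower_point k (s, j) x) \<partial>bern)"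
proof -
  let ?l = "\<lambda>t. ln (1 + 1 / real (length (window k s t) - j))"
  let ?g = "\<lambda>x. - (\<Sum>t\<in>UNIV. indicator {x :: point. x 0 = t} x * ?l t)"
  have letter: "{x :: point. x 0 = t} \<in> sets bern" for t
  proof -
    have "{x :: point. x 0 = t} = {y. \<forall>k\<le>0. (\<lambda>_. t) k = y k}" by auto
    then show ?thesis using open_prefix[of 0 "\<lambda>_. t"] by (simp add: sets_bern)
  qed
  have pt: "?g x \<le> potential N A (tower_point k (s, j) x)" for x
  proof -
    have len: "length (common k) \<le> length (window k s (x 0)) - j"
      using j by (simp add: window_def)
    have c: "1 \<le> length (common k)" using length_common[of k] less_Fibo[of "k + 2"] k by linarith
    have "enat (length (window k s (x 0)) - j) \<le> delta (tower_point k (s, j) x)"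
      using delta_fib_subst_ge[OF k, of j "conc [s] x"] j by (simp add: tower_point_def)
    then have "- ?l (x 0) \<le> potential N A (tower_point k (s, j) x)"
      by (rule potential_ge) (use len c N in linarith)+
    moreover have "?g x = - ?l (x 0)"
    proof -
      have "(\<Sum>t\<in>UNIV. indicator {x :: point. x 0 = t} x * ?l t) = (\<Sum>t\<in>UNIV. if t = x 0 then ?l t else 0)"
        by (intro sum.cong refl) (simp add: indicator_def)
      also have "\<dots> = ?l (x 0)" by (subst sum.delta) simp_all
      finally show ?thesis by (simp only:)
    qed
    ultimately show ?thesis by (simp only:)
  qed
  have ind: "integrable bern (\<lambda>x. indicator {x :: point. x 0 = t} x * ?l t)" for t
    using letter[of t] by (intro integrable_mult_left integrable_real_indicator)
      (simp_all add: bern.emeasure_eq_measure)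
  have val: "(\<integral>x. indicator {x :: point. x 0 = t} x * ?l t \<partial>bern) = prob_letter t * ?l t" for t
    using letter[of t] measure_bern_letter[of t] by (simp add: space_bern)
  have "- (\<Sum>t\<in>UNIV. prob_letter t * ?l t) = - (\<Sum>t\<in>UNIV. \<integral>x. indicator {x :: point. x 0 = t} x * ?l t \<partial>bern)"
    by (simp only: val)
  also have "\<dots> = (\<integral>x. ?g x \<partial>bern)"
    by (subst Bochner_Integration.integral_minus, subst Bochner_Integration.integral_sum[OF ind]) (rule refl)
  also have "\<dots> \<le> (\<integral>x. potential N A (tower_point k (s, j) x) \<partial>bern)"
    by (rule integral_mono[OF _ integrable_potential_comp[OF borel_measurable_tower_point A] pt])
      (intro Bochner_Integration.integrable_minus Bochner_Integration.integrable_sum ind)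
  finally show ?thesis .
qed

text \<open>Kac's formula: the levels summed block by block give the mean cost of a block divided by
  its mean length.\<close>

lemma integral_tower_ge:
  assumes A: "0 < A" and k: "0 < k" and N: "N \<le> length (common k)"
  shows "- (\<Sum>s\<in>UNIV. prob_letter s * (\<Sum>t\<in>UNIV. prob_letter t * cost k s t)) / mean_length k
    \<le> (\<integral>y. potential N A y \<partial>tower k)"
proof -
  let ?l = "\<lambda>s t j. ln (1 + 1 / real (length (window k s t) - j))"
  have c: "1 \<le> length (common k)" using length_common[of k] less_Fibo[of "k + 2"] k by linarith
  have cost: "(\<Sum>j<length (block k s). ?l s t j) = cost k s t" for s t
  proof -
    have "length (block k s) < length (window k s t)"
      using c length_block_pos[of k s] unfolding window_def length_append by linarith
    then show ?thesis unfolding cost_def by (rule sum_ln_telescope)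
  qed
  have "- (\<Sum>s\<in>UNIV. prob_letter s * (\<Sum>t\<in>UNIV. prob_letter t * cost k s t)) / mean_length k
      = (\<Sum>s\<in>UNIV. \<Sum>j<length (block k s). prob_letter s / mean_length k * - (\<Sum>t\<in>UNIV. prob_letter t * ?l s t j))"
  proof -
    have "(\<Sum>j<length (block k s). prob_letter s / mean_length k * - (\<Sum>t\<in>UNIV. prob_letter t * ?l s t j))
        = - (prob_letter s * (\<Sum>t\<in>UNIV. prob_letter t * cost k s t)) / mean_length k" for s
      unfolding cost[symmetric] sum_distrib_left[symmetric] sum_negf
      by (subst sum.swap) (simp add: sum_distrib_left sum_divide_distrib)
    then show ?thesis by (simp add: sum_divide_distrib sum_negf)
  qed
  also have "\<dots> = (\<Sum>d\<in>tower_index k. tower_weight k d * - (\<Sum>t\<in>UNIV. prob_letter t * ?l (fst d) t (snd d)))"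
    unfolding sum_tower_index by (intro sum.cong refl) (simp add: tower_weight_def tower_index_def)
  also have "\<dots> \<le> (\<integral>y. potential N A y \<partial>tower k)"
    unfolding integral_tower[OF A]
  proof (intro sum_mono mult_left_mono tower_weight_nonneg)
    fix d assume "d \<in> tower_index k"
    then show "- (\<Sum>t\<in>UNIV. prob_letter t * ?l (fst d) t (snd d)) \<le> (\<integral>x. potential N A (tower_point k d x) \<partial>bern)"
      using integral_tower_point_ge[OF A k N, of "snd d" "fst d"] by (auto simp: tower_index_def)
  qed
  finally show ?thesis .
qed

section \<open>Numerical estimates\<close>

lemma Fibo_ratio_nat:
  assumes "3 \<le> k"
  shows "8 * Fibo (Suc k) \<le> 13 * Fibo k \<and> 8 * Fibo k \<le> 5 * Fibo (Suc k)"
  using assms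
proof (induction k rule: dec_induct)
  case base
  show ?case by (simp add: Fibo_simps numeral_eq_Suc)
next
  case (step k)
  \<comment> \<open>Each bound at \<open>Suc k\<close> follows from the other one at
    \<open>k\<close>.\<close>
  then show ?case using Fibo_simps(3)[of k] by linarith
qed

text \<open>The ratio of the block lengths lies between 8/13 and 5/8, which bracket the inverse
  golden ratio.\<close>

lemma Fibo_ratio:
  assumes "3 \<le> k"
  shows "8 * real (Fibo (Suc k)) \<le> 13 * real (Fibo k)" "8 * real (Fibo k) \<le> 5 * real (Fibo (Suc k))"
  using Fibo_ratio_nat[OF assms] by linarith+

text \<open>The first two compare rational powers after exponentiation. The first makes the weight
  4/7 admissible for the rate \<open>ln (7/3) / p\<close>; the second says that a block has more
  entropy than twice its cost; the third keeps the mean cost below 1.\<close>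

lemma ln_ratio_bounds:
  "5 * ln (7/3) \<le> 8 * ln (7/4 :: real)" "50 * ln (7/5) + 24 * ln (9/5) < 38 * ln (7/3 :: real)"
  "25 * ln (7/5) + 12 * ln (9/5) \<le> (49 :: real)"
proof -
  have pow: "real n * ln x = ln (x ^ n)" if "0 < x" for x :: real and n
    using that by (simp add: ln_realpow)
  have "real 5 * ln (7/3) = ln ((7/3) ^ 5)" by (rule pow) simp
  also have "\<dots> \<le> ln ((7/4) ^ 8)"
    by (subst ln_le_cancel_iff) (simp_all add: power_divide)
  also have "\<dots> = real 8 * ln (7/4)" by (rule pow[symmetric]) simp
  finally show "5 * ln (7/3) \<le> 8 * ln (7/4 :: real)" by simp
  have "real 25 * ln (7/5) + real 12 * ln (9/5) = ln ((7/5) ^ 25) + ln ((9/5) ^ 12)"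
    by (intro arg_cong2[where f = "(+)"] pow) simp_all
  also have "\<dots> = ln ((7/5) ^ 25 * (9/5) ^ 12)"
    by (rule ln_mult_pos[symmetric]) simp_all
  also have "\<dots> < ln ((7/3) ^ 19)"
    by (subst ln_less_cancel_iff) (simp_all add: power_divide)
  also have "\<dots> = real 19 * ln (7/3)" by (rule pow[symmetric]) simp
  finally show "50 * ln (7/5) + 24 * ln (9/5) < 38 * ln (7/3 :: real)" by simp
  show "25 * ln (7/5) + 12 * ln (9/5) \<le> (49 :: real)"
    using ln_le_minus_one[of "7/5 :: real"] ln_le_minus_one[of "9/5 :: real"] by simp
qed

text \<open>The two mixed pairs have the same weight in the mean, so a bound on their sum is enough.
  At the golden ratio the arguments of the logarithms are about 1.382, 1.382 and 1.789;
  \<open>40 \<le> k\<close> absorbs the terms \<open>- 1\<close>.\<close>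

lemma cost_bounds:
  assumes k: "40 \<le> k"
  shows "cost k False False \<le> ln (7/5)" "cost k True True \<le> ln (7/5)"
    "cost k False True + cost k True False \<le> ln (9/5)"
proof -
  define p q where "p = real (Fibo (Suc k))" and "q = real (Fibo k)"
  have pq: "8 * p \<le> 13 * q" "8 * q \<le> 5 * p"
    using Fibo_ratio[of k] k by (simp_all add: p_def q_def)
  have p: "40 \<le> p" using less_Fibo[of "Suc k"] k by (simp add: p_def)
  have common: "real (length (common k)) = p + q - 2"
    using arg_cong[OF length_common[of k], of real] by (simp add: p_def q_def Fibo_simps)
  have cost: "cost k False False = ln ((3 * p + q - 1) / (2 * p + q - 1))"
      "cost k True True = ln ((p + 2 * q - 1) / (p + q - 1))"
      "cost k False True = ln ((2 * p + 2 * q - 1) / (p + 2 * q - 1))"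
      "cost k True False = ln ((2 * p + 2 * q - 1) / (2 * p + q - 1))"
    by (simp_all add: cost_def window_def length_block common algebra_simps flip: p_def q_def)
  have q: "24 \<le> q" using pq p by linarith
  show "cost k False False \<le> ln (7/5)"
    unfolding cost using pq p q by (subst ln_le_cancel_iff) (auto simp: field_simps)
  show "cost k True True \<le> ln (7/5)"
    unfolding cost using pq p q by (subst ln_le_cancel_iff) (auto simp: field_simps)
  have "cost k False True + cost k True False
      = ln ((2 * p + 2 * q - 1) / (p + 2 * q - 1) * ((2 * p + 2 * q - 1) / (2 * p + q - 1)))"
    unfolding cost using p q by (intro ln_mult_pos[symmetric]) (auto intro!: divide_pos_pos)
  also have "\<dots> \<le> ln (9/5)"
  proof (subst ln_le_cancel_iff)
    \<comment> \<open>Clearing denominators below leaves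
      \<open>7 * (p + q) - 4 \<le> (2 * p - q) * (2 * q - p)\<close>. The factors on the right are
      at least \<open>11/8 * p\<close> and \<open>3/13 * p\<close>, and \<open>40 \<le> p\<close>
      makes their product beat the linear terms.\<close>
    have "0 \<le> (2 * p - q - 11/8 * p) * (2 * q - p) + 11/8 * p * (2 * q - p - 3/13 * p)"
      using pq p q by (intro add_nonneg_nonneg mult_nonneg_nonneg) linarith+
    also have "\<dots> = (2 * p - q) * (2 * q - p) - 33/104 * (p * p)"
      by (simp add: field_simps)
    finally have "33/104 * (p * p) \<le> (2 * p - q) * (2 * q - p)"
      by simp
    moreover have "40 * p \<le> p * p"
      using p by (intro mult_right_mono) simp_all
    moreover have "7 * (p + q) \<le> 33/104 * (40 * p)"
      using pq p by simp
    ultimately have "7 * (p + q) \<le> (2 * p - q) * (2 * q - p)"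
      by linarith
    then have "5 * ((2 * p + 2 * q - 1) * (2 * p + 2 * q - 1)) \<le> 9 * ((p + 2 * q - 1) * (2 * p + q - 1))"
      by (simp add: algebra_simps)
    then have "((2 * p + 2 * q - 1) * (2 * p + 2 * q - 1)) / ((p + 2 * q - 1) * (2 * p + q - 1)) \<le> 9/5"
      using p q by (subst pos_divide_le_eq) (auto intro!: mult_pos_pos)
    then show "(2 * p + 2 * q - 1) / (p + 2 * q - 1) * ((2 * p + 2 * q - 1) / (2 * p + q - 1)) \<le> 9/5"
      by simp
  qed (use p q in \<open>auto intro!: mult_pos_pos divide_pos_pos\<close>)
  finally show "cost k False True + cost k True False \<le> ln (9/5)" .
qed

lemma tower_free_energy:
  assumes k: "40 \<le> k" "N \<le> k" and A: "0 < A"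
  obtains h where "0 \<le> h" "ereal h \<le> kolmogorov_entropy (tower k) shift"
    "0 < h + 2 * (\<integral>y. potential N A y \<partial>tower k)" "- 1 / real k \<le> (\<integral>y. potential N A y \<partial>tower k)"
proof -
  define p q where "p = real (Fibo (Suc k))" and "q = real (Fibo k)"
  have pq: "8 * p \<le> 13 * q" "8 * q \<le> 5 * p"
    using Fibo_ratio[of k] k by (simp_all add: p_def q_def)
  have p: "40 \<le> p" using less_Fibo[of "Suc k"] k by (simp add: p_def)
  have qk: "real k \<le> q" using less_Fibo[of k] by (simp add: q_def)
  have k0: "0 < k" using k by simp
  have N: "N \<le> length (common k)"
    using length_common[of k] less_Fibo[of "k + 2"] k by linarith
  \<comment> \<open>Bounds the mean cost of a block: equal letters have weights 9/49 and 16/49, each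
    mixed pair has 12/49.\<close>
  define \<kappa> where "\<kappa> = (25 * ln (7/5) + 12 * ln (9/5 :: real)) / 49"
  define E where "E = mean_length k"
  define I where "I = (\<integral>y. potential N A y \<partial>tower k)"
  have E: "E = 3/7 * p + 4/7 * q"
    by (simp add: E_def mean_length_def UNIV_bool prob_letter_def length_block p_def q_def)
  have Ek: "0 < E" "k \<le> E" using qk pq p k unfolding E by linarith+
  have "(\<Sum>s\<in>UNIV. prob_letter s * (\<Sum>t\<in>UNIV. prob_letter t * cost k s t)) \<le> \<kappa>"
    using cost_bounds[OF k(1)] by (simp add: UNIV_bool prob_letter_def \<kappa>_def field_simps)
  then have "- \<kappa> / E \<le> - (\<Sum>s\<in>UNIV. prob_letter s * (\<Sum>t\<in>UNIV. prob_letter t * cost k s t)) / E"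
    using Ek(1) by (intro divide_right_mono) simp_all
  also have "\<dots> \<le> I"
    unfolding I_def E_def by (rule integral_tower_ge[OF A k0 N])
  finally have I: "- \<kappa> / E \<le> I" .
  \<comment> \<open>At this rate the longer block gets exactly its weight 3/7, and
    \<open>q / p \<le> 5/8\<close> takes care of the shorter one.\<close>
  define h where "h = ln (7/3) / p"
  have ln0: "0 < ln (7/3 :: real)" by simp
  have h0: "0 \<le> h" using p by (simp add: h_def)
  have "ereal h \<le> kolmogorov_entropy (tower k) shift"
  proof (rule tower_entropy_ge[OF k0 h0])
    fix s show "prob_letter s \<le> exp (- (h * length (block k s)))"
    proof (cases s)
      case True
      have "h * q = ln (7/3) * (q / p)" by (simp add: h_def)
      also have "\<dots> \<le> ln (7/3) * (5/8)"
        using pq p by (intro mult_left_mono) (simp_all add: field_simps)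
      also have "\<dots> \<le> ln (7/4)" using ln_ratio_bounds(1) by simp
      finally have "exp (- ln (7/4)) \<le> exp (- (h * q))" by simp
      then show ?thesis
        using True by (simp add: prob_letter_def length_block exp_minus flip: q_def)
    next
      case False
      have "h * p = ln (7/3)" using p by (simp add: h_def)
      then show ?thesis
        using False by (simp add: prob_letter_def length_block exp_minus flip: p_def)
    qed
  qed
  moreover have "0 < h + 2 * I"
  proof -
    \<comment> \<open>From \<open>8 * p \<le> 13 * q\<close>, \<open>E\<close> is at least
      \<open>71/91 * p\<close>; the slightly smaller 38/49 shares the denominator of
      \<open>\<kappa>\<close>.\<close>
    have "38 * 13 * p \<le> 49 * 13 * E" using pq unfolding E by simp
    then have "38/49 \<le> E / p" using p by (simp add: field_simps)
    then have "38/49 * ln (7/3) \<le> E / p * ln (7/3)" using ln0 by (intro mult_right_mono) simp_all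
    then have "2 * \<kappa> < E * h"
      using ln_ratio_bounds(2) by (simp add: \<kappa>_def h_def)
    then have "0 < h - 2 * \<kappa> / E" using Ek(1) by (simp add: field_simps)
    then show ?thesis using I by simp
  qed
  moreover have "- 1 / real k \<le> I"
  proof -
    have "\<kappa> \<le> 1" using ln_ratio_bounds(3) by (simp add: \<kappa>_def)
    then have "\<kappa> / E \<le> 1 / real k" using Ek k0 by (intro frac_le) simp_all
    then show ?thesis using I by simp
  qed
  ultimately show thesis using h0 that unfolding I_def by blast
qed

text \<open>Almost every word read is a factor, and along the lengths of \<open>card_factors\<close>
  their number grows linearly, so its logarithm is negligible against the length.\<close>

lemma (in shift_invariant) kolmogorov_entropy_fib_subshift:
  assumes "AE x in M. delta x = \<infinity>"
  shows "kolmogorov_entropy M shift \<le> 0"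
  unfolding zero_ereal_def
proof (rule kolmogorov_entropy_le)
  fix e :: real and m :: nat assume e: "0 < e"
  \<comment> \<open>Makes \<open>sqrt y\<close> at least \<open>4 / e\<close>, hence
    \<open>2 * sqrt y \<le> y / 2 * e\<close>, and keeps \<open>n\<close> above \<open>y / 2\<close>
    despite the overhang \<open>m\<close>.\<close>
  obtain k :: nat where k: "(4 / e)\<^sup>2 + 2 * m + 4 + 2 < k" using reals_Archimedean2 by blast
  define n where "n = length (common k) - m"
  define y where "y = real (Fibo (k + 2))"
  have ky: "real k < y" using less_Fibo[of "k + 2"] by (simp add: y_def)
  have c: "real (length (common k)) + 2 = y"
    using arg_cong[OF length_common[of k], of real] by (simp add: y_def)
  have sq: "0 \<le> (4 / e)\<^sup>2" by simp
  have "m < length (common k)" using c k ky sq by linarith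
  then have n: "1 \<le> n" "n + m = length (common k)" "real n = y - 2 - m"
    using c by (auto simp: n_def of_nat_diff)
  have k0: "0 < k" using k sq by (cases k) auto
  let ?V = "{w \<in> factors fib_omega. length w = length (common k)}"
  have "ent M (name (\<lambda>x. x 0) (n + m)) \<le> ln (card ?V)"
  proof (rule ent_le_ln_card)
    show "simple_function M (name (\<lambda>x. x 0) (n + m))"
      by (intro simple_function_name simple_function_letter)
    show "finite ?V" using k0 by (rule card_factors(1))
    show "AE x in M. name (\<lambda>x. x 0) (n + m) x \<in> ?V"
      using assms
    proof eventually_elim
      case (elim x)
      then have "map x [0..<n + m] \<in> factors fib_omega" using delta_ge_iff[of "n + m" x] by simp
      then show ?case using n(2) by (simp add: name_letter)
    qed
  qed
  also have "\<dots> \<le> ln y"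
  proof -
    have "1 \<le> y" using ky k sq by linarith
    show ?thesis
    proof (cases "card ?V = 0")
      case True
      then show ?thesis using \<open>1 \<le> y\<close> by simp
    next
      case False
      then show ?thesis
        using card_factors(2)[OF k0] by (subst ln_le_cancel_iff) (auto simp: y_def)
    qed
  qed
  also have "\<dots> \<le> 2 * sqrt y"
  proof -
    have "ln y = 2 * ln (sqrt y)" using ky by (simp add: ln_sqrt)
    also have "\<dots> \<le> 2 * sqrt y" using ln_le_minus_one[of "sqrt y"] ky by simp
    finally show ?thesis .
  qed
  also have "\<dots> \<le> y / 2 * e"
  proof -
    have "4 / e \<le> sqrt y"
      using k ky sq by (intro real_le_rsqrt) linarith
    then have "4 \<le> sqrt y * e" using e by (simp add: field_simps)
    then have "sqrt y * 4 \<le> sqrt y * (sqrt y * e)" using ky by (intro mult_left_mono) simp_all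
    also have "\<dots> = y * e" using ky by (simp flip: mult.assoc)
    finally show ?thesis by simp
  qed
  also have "\<dots> \<le> n * (0 + e)"
  proof -
    have "y / 2 \<le> n" using n(3) k ky sq by linarith
    then show ?thesis using e by (simp add: mult_right_mono)
  qed
  finally show "\<exists>n\<ge>1. ent M (name (\<lambda>x. x 0) (n + m)) \<le> n * (0 + e)"
    using n(1) by blast
qed

lemma invariant_prob_iff: "invariant_prob M \<longleftrightarrow> shift_invariant M"
proof
  assume M: "invariant_prob M"
  then have "sets M = sets borel" by (simp add: invariant_prob_def)
  then show "shift_invariant M"
    using M by (auto simp: invariant_prob_def shift_invariant_def shift_invariant_axioms_def)
next
  assume "shift_invariant M"
  then show "invariant_prob M"
    by (auto simp: invariant_prob_def shift_invariant_def shift_invariant_axioms_def)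
qed

theorem transition_point_gt_2:
  assumes A: "0 < A" and frozen: "frozen_beyond (potential N A) \<beta>c"
  shows "2 < \<beta>c"
proof (rule ccontr)
  assume "\<not> 2 < \<beta>c"
  let ?\<phi> = "potential N A"
  have eq: "equilibrium_state ?\<phi> \<beta> mu_K" if "2 < \<beta>" for \<beta>
    using frozen that \<open>\<not> 2 < \<beta>c\<close> by (simp add: frozen_beyond_def)
  \<comment> \<open>Invariance is read off from \<open>mu_K\<close> being an equilibrium state; that
    it lives on the subshift is derived below.\<close>
  have "invariant_prob mu_K"
    using eq[of 3] by (simp add: equilibrium_state_def)
  then interpret K: shift_invariant mu_K by (simp add: invariant_prob_iff)
  define I0 where "I0 = (\<integral>x. ?\<phi> x \<partial>mu_K)"
  \<comment> \<open>The variational inequality in real numbers, with bounds \<open>h\<close> and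
    \<open>c\<close> in place of the two entropies.\<close>
  have max: "h + \<beta> * (\<integral>y. ?\<phi> y \<partial>tower k) \<le> c + \<beta> * I0"
    if \<beta>: "2 < \<beta>" and h: "ereal h \<le> kolmogorov_entropy (tower k) shift"
      and c: "kolmogorov_entropy mu_K shift \<le> ereal c" for \<beta> h k c
  proof -
    have "ereal (h + \<beta> * (\<integral>y. ?\<phi> y \<partial>tower k)) \<le> free_energy ?\<phi> \<beta> (tower k)"
      using add_right_mono[OF h, of "ereal (\<beta> * (\<integral>y. ?\<phi> y \<partial>tower k))"] by (simp add: free_energy_def)
    also have "\<dots> \<le> pressure ?\<phi> \<beta>"
      unfolding pressure_def using shift_invariant_tower[of k] by (intro SUP_upper) (simp add: invariant_prob_iff)
    also have "\<dots> = free_energy ?\<phi> \<beta> mu_K"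
      using eq[OF \<beta>] by (simp add: equilibrium_state_def)
    also have "\<dots> \<le> ereal (c + \<beta> * I0)"
      using add_right_mono[OF c, of "ereal (\<beta> * I0)"] by (simp add: free_energy_def I0_def)
    finally show ?thesis by simp
  qed
  have lower: "- e \<le> I0" if e: "0 < e" for e :: real
  proof -
    obtain k :: nat where k: "max (1 / e) (max 40 N) < k" using reals_Archimedean2 by blast
    then have k': "40 \<le> k" "N \<le> k" "1 / e < k" by auto
    obtain h where h: "0 \<le> h" "ereal h \<le> kolmogorov_entropy (tower k) shift"
        "- 1 / real k \<le> (\<integral>y. ?\<phi> y \<partial>tower k)"
      using tower_free_energy[OF k'(1,2) A] by metis
    have "1 / real k < e" using k'(3) e k'(1) by (simp add: field_simps)
    then have I: "- e \<le> (\<integral>y. ?\<phi> y \<partial>tower k)" using h(3) by simp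
    have slack: "- e - d \<le> I0" if d: "0 < d" for d
    proof -
      \<comment> \<open>With \<open>\<beta> \<ge> 1 / d\<close>, the term \<open>d * \<beta>\<close>
        absorbs the entropy bound \<open>ln 2 \<le> 1\<close>.\<close>
      define \<beta> where "\<beta> = max 3 (1 / d)"
      have \<beta>: "2 < \<beta>" "1 \<le> d * \<beta>" using d by (auto simp: \<beta>_def field_simps max_def)
      have "\<beta> * - e \<le> \<beta> * (\<integral>y. ?\<phi> y \<partial>tower k)" using I \<beta> by (intro mult_left_mono) auto
      also have "\<dots> \<le> ln 2 + \<beta> * I0"
        using max[OF \<beta>(1) h(2) K.kolmogorov_entropy_le_ln2] h(1) by linarith
      also have "\<dots> \<le> \<beta> * (d + I0)"
        using \<beta>(2) ln_le_minus_one[of "2 :: real"] by (simp add: algebra_simps)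
      finally have "- e \<le> d + I0"
        using \<beta>(1) by (subst (asm) mult_le_cancel_left_pos) auto
      then show ?thesis by linarith
    qed
    have "- e \<le> I0 + d" if "0 < d" for d using slack[OF that] by linarith
    then show ?thesis by (rule field_le_epsilon)
  qed
  have "0 \<le> I0 + e" if "0 < e" for e using lower[OF that] by linarith
  then have "0 \<le> I0" by (rule field_le_epsilon)
  moreover have int: "integrable mu_K ?\<phi>"
    using K.prob_space_axioms K.sets_borel A by (rule integrable_potential)
  moreover have "0 \<le> (\<integral>x. - ?\<phi> x \<partial>mu_K)"
    using potential_nonpos[OF A] by (intro integral_nonneg_AE) simp
  ultimately have "(\<integral>x. - ?\<phi> x \<partial>mu_K) = 0" by (simp add: I0_def)
  then have "AE x in mu_K. - ?\<phi> x = 0"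
    using int potential_nonpos[OF A] by (subst (asm) integral_nonneg_eq_0_iff_AE) auto
  then have "AE x in mu_K. delta x = \<infinity>"
    by (rule eventually_mono) (simp add: potential_eq_0[OF A])
  then have h0: "kolmogorov_entropy mu_K shift \<le> ereal 0"
    using K.kolmogorov_entropy_fib_subshift by (simp add: zero_ereal_def)
  have "0 = I0" using \<open>(\<integral>x. - ?\<phi> x \<partial>mu_K) = 0\<close> by (simp add: I0_def)
  define k where "k = max 40 N"
  obtain h where h: "ereal h \<le> kolmogorov_entropy (tower k) shift"
      "0 < h + 2 * (\<integral>y. ?\<phi> y \<partial>tower k)"
    using tower_free_energy[of k N A] A by (metis k_def max.cobounded1 max.cobounded2)
  define I where "I = (\<integral>y. ?\<phi> y \<partial>tower k)"
  have "h + \<beta> * I \<le> 0" if "2 < \<beta>" for \<beta>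
    using max[OF that h(1) h0] \<open>0 = I0\<close> by (simp add: I_def)
  \<comment> \<open>The comparison is available for \<open>\<beta> > 2\<close> only;
    \<open>\<beta> = 2 + d\<close> with \<open>d * \<bar>I\<bar> \<le> e\<close> passes to the limit
    2.\<close>
  have "h + 2 * I \<le> 0 + e" if e: "0 < e" for e
  proof -
    define d where "d = e / (\<bar>I\<bar> + 1)"
    have d: "0 < d" "d * \<bar>I\<bar> \<le> e" using e by (simp_all add: d_def field_simps)
    have "h + (2 + d) * I \<le> 0" using \<open>\<And>\<beta>. 2 < \<beta> \<Longrightarrow> h + \<beta> * I \<le> 0\<close> d by simp
    moreover have "- (d * I) \<le> d * \<bar>I\<bar>" using d(1) by (simp add: abs_if)
    ultimately show ?thesis using d(2) by (simp add: algebra_simps)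
  qed
  then have "h + 2 * I \<le> 0" by (rule field_le_epsilon)
  then show False using h(2) by (simp add: I_def)
qed

theorem theorem1:
  shows "\<exists>N0 :: nat. \<forall>N\<ge>N0. (\<forall>n\<ge>2. int N - 1 \<noteq> int (Fibo n) - 2) \<longrightarrow>
    (\<forall>A :: real. A > 0 \<longrightarrow>
      (\<forall>\<beta>c :: real. is_transition_point (potential N A) \<beta>c \<longrightarrow> \<beta>c \<notin> {0<..2}))"
  using transition_point_gt_2 by (force simp: is_transition_point_def)

end
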